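(* Let $(M,d)$ be a length space, with length structure $(\mathcal{P},\ell)$ (so $d=d^\ell$), and let $\omega$ be a weight. Then $(\mathcal{P}^{\mathrm{Ran}},\ell^\omega)$ is a length structure on $\mathrm{Ran}(M)$ (with the topology induced by $d^\omega$), and the metric on $\mathrm{Ran}(M)$ associated to it is $d^\omega$; that is, for all $X,Y\in\mathrm{Ran}(M)$, $$d^\omega(X,Y)=\inf\{\ell^\omega(\Gamma)\mid \Gamma\colon[a,b]\to\mathrm{Ran}(M)\text{ in }\mathcal{P}^{\mathrm{Ran}},\ \Gamma(a)=X,\ \Gamma(b)=Y\}.$$
   Context: Length structures. A length structure on a topological space $T$ is a set $\mathcal{P}$ of continuous paths $\gamma\colon[a,b]\to T$ ($a\le b$ real), called admissible, and a map $\ell\colon\mathcal{P}\to\mathbb{R}_+$ such that: (1) for a continuous path $\gamma\colon[a,b]\to T$ and $c\in[a,b]$, $\gamma\in\mathcal{P}$ iff $\gamma|_{[a,c]}\in\mathcal{P}$ and $\gamma|_{[c,b]}\in\mathcal{P}$, and then $\ell(\gamma)=\ell(\gamma|_{[a,c]})+\ell(\gamma|_{[c,b]})$; (2) for every affine homeomorphism $\varphi\colon[c,d]\to[a,b]$, $\gamma\in\mathcal{P}$ iff $\gamma\circ\varphi\in\mathcal{P}$, and then $\ell(\gamma)=\ell(\gamma\circ\varphi)$; (3) for $\gamma\colon[a,b]\to T$ in $\mathcal{P}$, $t\mapsto\ell(\gamma|_{[a,t]})$ is continuous on $[a,b]$; (4) for $x\in T$ and $U$ a neighborhood of $x$, there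 is $\epsilon>0$ such that $\ell(\gamma)>\epsilon$ for every $\gamma\colon[a,b]\to T$ in $\mathcal{P}$ with $\gamma(a)=x$, $\gamma(b)\notin U$. The associated metric (for $T$ Hausdorff) is $d^\ell(x,y)=\inf\{\ell(\gamma)\mid\gamma\in\mathcal{P},\ x,y\in\mathrm{Im}(\gamma)\}$. A length space is a space with a length structure such that $d^\ell$ is a distance inducing the topology; it is then regarded as a metric space with $d=d^\ell$. Weighted distance. $\mathrm{Ran}(M)$ is the set of non-empty finite subsets of $M$. A weight is a non-decreasing function $\omega\colon\{1,2,\dots\}\to[1,\infty)$ with $\omega(1)=1$. A surjective relation from $X$ to $Y$ ($X,Y\in\mathrm{Ran}(M)$) is a subset $R\subset X\times Y$ projecting onto $X$ and onto $Y$; $\ell^\omega(R)=\omega(\mathrm{card}(R))\sum_{(x,y)\in R}d(x,y)$. A combinatorial chain from $X$ to $Y$ consists of $X=X_0,\dots,X_k=Y$ in $\mathrm{Ran}(M)$ and surjective relations $R_j$ from $X_j$ to $X_{j+1}$; its $\omega$-length is $\sum_j\ell^\omega(R_j)$. $d^\omega(X,Y)$ is the infimum of the $\omega$-lengths of combinatorial chains from $X$ to $Y$; it is a metric on $\mathrm{Ran}(M)$. Paths in $\mathrm{Ran}(M)$. Let $\pi_n\colon M^n\to\mathrm{Ran}(M)$ send a tuple to its set of coordinates. A lift of a path $\Gamma\colon[a,b]\to\mathrm{Ran}(M)$ is a subdivision $a=t_0<\dots<t_k=b$ ($k\ge0$) together with continuous paths $\underline{\gamma_i}=(\gamma_i^{(1)},\dots,\gamma_i^{(n_i)})\colon[t_i,t_{i+1}]\to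 M^{n_i}$, $n_i\ge1$, $0\le i\le k-1$, with $\pi_{n_i}(\underline{\gamma_i}(t))=\Gamma(t)$ for all $t\in[t_i,t_{i+1}]$. The lift is admissible if every $\gamma_i^{(j)}$ is in $\mathcal{P}$. $\mathcal{P}^{\mathrm{Ran}}$ is the set of continuous paths $\Gamma$ in $\mathrm{Ran}(M)$ that have an admissible lift (the existence of a lift already implies continuity of $\Gamma$ for $d^\omega$, so the choice of topology is immaterial). The length of an admissible lift is $\ell^\omega(\underline{\gamma_0},\dots,\underline{\gamma_{k-1}})=\sum_{i=0}^{k-1}\omega(n_i)\sum_{j=1}^{n_i}\ell(\gamma_i^{(j)})$, and $\ell^\omega(\Gamma)$ is the infimum of the lengths of the admissible lifts of $\Gamma$. *)

theory Defs
  imports "HOL-Analysis.Analysis"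
begin

text \<open>A path \<open>\<gamma> : [a,b] \<rightarrow> T\<close> is a triple \<open>(a, b, \<gamma>)\<close> whose last component is \<open>undefined\<close>
  outside \<open>[a,b]\<close>, so that equality of triples is equality of paths. The degenerate case
  \<open>a = b\<close> is allowed.\<close>

type_synonym 'a ipath = "real \<times> real \<times> (real \<Rightarrow> 'a)"

definition cpaths :: "'a topology \<Rightarrow> 'a ipath set" where
  "cpaths T = {(a, b, \<gamma>). a \<le> b \<and> \<gamma> \<in> extensional {a..b} \<and>
                          continuous_map (top_of_set {a..b}) T \<gamma>}"

definition affine_homeo :: "(real \<Rightarrow> real) \<Rightarrow> real \<Rightarrow> real \<Rightarrow> real \<Rightarrow> real \<Rightarrow> bool" where
  "affine_homeo \<phi> c d a b \<longleftrightarrow>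
     bij_betw \<phi> {c..d} {a..b} \<and> (\<exists>m q. \<forall>s\<in>{c..d}. \<phi> s = m * s + q)"

locale length_structure =
  fixes T :: "'a topology" and P :: "'a ipath set" and L :: "'a ipath \<Rightarrow> real"
  assumes P_subset: "P \<subseteq> cpaths T"
    and L_nonneg: "\<And>p. p \<in> P \<Longrightarrow> 0 \<le> L p"
    and P_split: "\<And>a b \<gamma> c. \<lbrakk>(a, b, \<gamma>) \<in> cpaths T; c \<in> {a..b}\<rbrakk> \<Longrightarrow>
          (a, b, \<gamma>) \<in> P \<longleftrightarrow>
            (a, c, restrict \<gamma> {a..c}) \<in> P \<and> (c, b, restrict \<gamma> {c..b}) \<in> P"
    and L_split: "\<And>a b \<gamma> c. \<lbrakk>(a, b, \<gamma>) \<in> P; c \<in> {a..b}\<rbrakk> \<Longrightarrow>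
          L (a, b, \<gamma>) = L (a, c, restrict \<gamma> {a..c}) + L (c, b, restrict \<gamma> {c..b})"
    and P_affine: "\<And>a b \<gamma> c d \<phi>. \<lbrakk>(a, b, \<gamma>) \<in> cpaths T; affine_homeo \<phi> c d a b\<rbrakk> \<Longrightarrow>
          (a, b, \<gamma>) \<in> P \<longleftrightarrow> (c, d, compose {c..d} \<gamma> \<phi>) \<in> P"
    and L_affine: "\<And>a b \<gamma> c d \<phi>. \<lbrakk>(a, b, \<gamma>) \<in> P; affine_homeo \<phi> c d a b\<rbrakk> \<Longrightarrow>
          L (a, b, \<gamma>) = L (c, d, compose {c..d} \<gamma> \<phi>)"
    and L_continuous: "\<And>a b \<gamma>. (a, b, \<gamma>) \<in> P \<Longrightarrow>
          continuous_on {a..b} (\<lambda>t. L (a, t, restrict \<gamma> {a..t}))"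
    and L_separates: "\<And>x U V. \<lbrakk>openin T V; x \<in> V; V \<subseteq> U; U \<subseteq> topspace T\<rbrakk> \<Longrightarrow>
          \<exists>\<epsilon>>0. \<forall>a b \<gamma>. (a, b, \<gamma>) \<in> P \<and> \<gamma> a = x \<and> \<gamma> b \<notin> U \<longrightarrow> L (a, b, \<gamma>) > \<epsilon>"

text \<open>The infimum is taken in the extended reals: it is \<open>\<infinity>\<close> when no admissible path
  passes through both points.\<close>

definition length_edist :: "'a ipath set \<Rightarrow> ('a ipath \<Rightarrow> real) \<Rightarrow> 'a \<Rightarrow> 'a \<Rightarrow> ereal" where
  "length_edist P L x y =
     Inf {ereal (L (a, b, \<gamma>)) |a b \<gamma>. (a, b, \<gamma>) \<in> P \<and> x \<in> \<gamma> ` {a..b} \<and> y \<in> \<gamma> ` {a..b}}"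

definition length_dist :: "'a ipath set \<Rightarrow> ('a ipath \<Rightarrow> real) \<Rightarrow> 'a \<Rightarrow> 'a \<Rightarrow> real" where
  "length_dist P L x y = real_of_ereal (length_edist P L x y)"

locale length_space = length_structure +
  assumes finite_edist: "\<And>x y. \<lbrakk>x \<in> topspace T; y \<in> topspace T\<rbrakk> \<Longrightarrow> length_edist P L x y \<noteq> \<infinity>"
    and metric: "Metric_space (topspace T) (length_dist P L)"
    and induces_topology: "Metric_space.mtopology (topspace T) (length_dist P L) = T"


definition Ran :: "'a set \<Rightarrow> 'a set set" where
  "Ran M = {X. X \<subseteq> M \<and> finite X \<and> X \<noteq> {}}"

text \<open>Only the values of a weight at positive integers matter; \<open>\<omega> 0\<close> is unconstrained.\<close>

definition weight :: "(nat \<Rightarrow> real) \<Rightarrow> bool" where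
  "weight \<omega> \<longleftrightarrow> mono_on {1..} \<omega> \<and> (\<forall>n\<ge>1. 1 \<le> \<omega> n) \<and> \<omega> 1 = 1"

definition surj_rel :: "('a \<times> 'a) set \<Rightarrow> 'a set \<Rightarrow> 'a set \<Rightarrow> bool" where
  "surj_rel R X Y \<longleftrightarrow> R \<subseteq> X \<times> Y \<and> fst ` R = X \<and> snd ` R = Y"

definition rel_length :: "(nat \<Rightarrow> real) \<Rightarrow> ('a \<Rightarrow> 'a \<Rightarrow> real) \<Rightarrow> ('a \<times> 'a) set \<Rightarrow> real" where
  "rel_length \<omega> d R = \<omega> (card R) * (\<Sum>(x, y)\<in>R. d x y)"

definition comb_chain ::
  "'a set \<Rightarrow> 'a set \<Rightarrow> 'a set \<Rightarrow> nat \<Rightarrow> (nat \<Rightarrow> 'a set) \<Rightarrow> (nat \<Rightarrow> ('a \<times> 'a) set) \<Rightarrow> bool" where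
  "comb_chain M X Y k Z R \<longleftrightarrow> Z 0 = X \<and> Z k = Y \<and> (\<forall>j\<le>k. Z j \<in> Ran M) \<and>
     (\<forall>j<k. surj_rel (R j) (Z j) (Z (Suc j)))"

text \<open>For \<open>X, Y \<in> Ran M\<close> there is always a chain (the relation \<open>X \<times> Y\<close>), so the real infimum is
  meaningful. The value \<open>0\<close> elsewhere is there because \<open>Metric_space\<close> requires symmetry and
  nonnegativity outside the carrier too.\<close>

definition ran_dist ::
  "(nat \<Rightarrow> real) \<Rightarrow> 'a set \<Rightarrow> ('a \<Rightarrow> 'a \<Rightarrow> real) \<Rightarrow> 'a set \<Rightarrow> 'a set \<Rightarrow> real" where
  "ran_dist \<omega> M d X Y =
     (if X \<in> Ran M \<and> Y \<in> Ran M
      then Inf {\<Sum>j<k. rel_length \<omega> d (R j) |k Z R. comb_chain M X Y k Z R}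
      else 0)"

definition ran_topology ::
  "(nat \<Rightarrow> real) \<Rightarrow> 'a set \<Rightarrow> ('a \<Rightarrow> 'a \<Rightarrow> real) \<Rightarrow> 'a set topology" where
  "ran_topology \<omega> M d = Metric_space.mtopology (Ran M) (ran_dist \<omega> M d)"


text \<open>Points of \<open>M\<^sup>n\<close> are extensional functions on \<open>{..<n}\<close>, with the product topology.\<close>

definition coord_set :: "nat \<Rightarrow> (nat \<Rightarrow> 'a) \<Rightarrow> 'a set" where
  "coord_set n x = x ` {..<n}"

text \<open>A lift with \<open>k\<close> pieces: subdivision points \<open>t 0 < \<dots> < t k\<close> and, for \<open>i < k\<close>, a path
  \<open>g i\<close> in \<open>M\<close> to the power \<open>n i\<close>. Values of \<open>t\<close>, \<open>n\<close>, \<open>g\<close> at larger indices are irrelevant.\<close>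

definition is_lift ::
  "'a topology \<Rightarrow> 'a set ipath \<Rightarrow> nat \<Rightarrow> (nat \<Rightarrow> real) \<Rightarrow> (nat \<Rightarrow> nat) \<Rightarrow>
     (nat \<Rightarrow> real \<Rightarrow> nat \<Rightarrow> 'a) \<Rightarrow> bool" where
  "is_lift T = (\<lambda>(a, b, \<Gamma>) k t n g.
     t 0 = a \<and> t k = b \<and> (\<forall>i<k. t i < t (Suc i)) \<and>
     (\<forall>i<k. n i \<ge> 1 \<and>
            (t i, t (Suc i), g i) \<in> cpaths (product_topology (\<lambda>_. T) {..<n i}) \<and>
            (\<forall>s\<in>{t i..t (Suc i)}. coord_set (n i) (g i s) = \<Gamma> s)))"

definition coord_path :: "(nat \<Rightarrow> real) \<Rightarrow> (nat \<Rightarrow> real \<Rightarrow> nat \<Rightarrow> 'a) \<Rightarrow> nat \<Rightarrow> nat \<Rightarrow> 'a ipath" where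
  "coord_path t g i j = (t i, t (Suc i), restrict (\<lambda>s. g i s j) {t i..t (Suc i)})"

definition admissible_lift ::
  "'a topology \<Rightarrow> 'a ipath set \<Rightarrow> 'a set ipath \<Rightarrow> nat \<Rightarrow> (nat \<Rightarrow> real) \<Rightarrow> (nat \<Rightarrow> nat) \<Rightarrow>
     (nat \<Rightarrow> real \<Rightarrow> nat \<Rightarrow> 'a) \<Rightarrow> bool" where
  "admissible_lift T P p k t n g \<longleftrightarrow>
     is_lift T p k t n g \<and> (\<forall>i<k. \<forall>j<n i. coord_path t g i j \<in> P)"

definition lift_length ::
  "(nat \<Rightarrow> real) \<Rightarrow> ('a ipath \<Rightarrow> real) \<Rightarrow> nat \<Rightarrow> (nat \<Rightarrow> real) \<Rightarrow> (nat \<Rightarrow> nat) \<Rightarrow>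
     (nat \<Rightarrow> real \<Rightarrow> nat \<Rightarrow> 'a) \<Rightarrow> real" where
  "lift_length \<omega> L k t n g = (\<Sum>i<k. \<omega> (n i) * (\<Sum>j<n i. L (coord_path t g i j)))"

definition ran_paths ::
  "(nat \<Rightarrow> real) \<Rightarrow> 'a topology \<Rightarrow> 'a ipath set \<Rightarrow> ('a ipath \<Rightarrow> real) \<Rightarrow> 'a set ipath set" where
  "ran_paths \<omega> T P L =
     {p \<in> cpaths (ran_topology \<omega> (topspace T) (length_dist P L)).
        \<exists>k t n g. admissible_lift T P p k t n g}"

definition ran_length ::
  "(nat \<Rightarrow> real) \<Rightarrow> 'a topology \<Rightarrow> 'a ipath set \<Rightarrow> ('a ipath \<Rightarrow> real) \<Rightarrow> 'a set ipath \<Rightarrow> real" where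
  "ran_length \<omega> T P L p =
     Inf {lift_length \<omega> L k t n g |k t n g. admissible_lift T P p k t n g}"

end

theory Submission
  imports Defs
begin

text \<open>
  Two comparisons carry the proof. A piece of a lift with \<open>n\<close> admissible coordinates runs from
  \<open>\<Gamma> c\<close> to \<open>\<Gamma> b\<close>; pairing the two endpoints of each coordinate gives a surjective relation with
  at most \<open>n\<close> elements. Since \<open>\<omega>\<close> is non-decreasing and \<open>d\<close> is bounded by the length of paths,
  its weighted length is at most that of the piece (\<open>dist_le_piece_length\<close>). Hence the weighted
  distance of the endpoints is at most the length of any lift. Conversely, a surjective relation
  becomes a piece of a lift by choosing almost shortest admissible paths, one for each of its
  pairs, so every combinatorial chain is followed by a path that is hardly longer
  (\<open>surj_rel_path\<close>, \<open>chain_path\<close>). Together these say that the weighted distance is the infimum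
  of the lengths of paths.

  Two boundary phenomena need attention. Constant paths on a nondegenerate interval need not be
  admissible, so a pair \<open>(x, x)\<close> is realised by a short loop: go a little way along a
  nondegenerate path from \<open>x\<close> and return (\<open>short_loop\<close>). This requires a second point in the
  space; a one-point space has only one non-empty finite subset, and a path on a one-point interval
  suffices there.

  For the axioms of a length structure the main tool is an arclength function: a lift of \<open>\<Gamma>\<close>
  on \<open>[a,b]\<close> yields a continuous \<open>F\<close> such that \<open>\<Gamma>\<close> restricted to \<open>[s,t]\<close> has a lift of length
  \<open>F t - F s\<close> (\<open>lifted_arclength\<close>). Cutting lifts, the continuity of \<open>\<Gamma>\<close> in the weighted
  distance, and the continuity of the length of an initial part of \<open>\<Gamma>\<close> all follow from it,
  because distance and infimal length are dominated by increments of \<open>F\<close>. Separation holds because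
  a path leaving the ball of radius \<open>r\<close> about its starting point has length at least \<open>r\<close>.

  Chains and lifts are indexed by subdivisions, which makes concatenation awkward. Both are therefore
  replaced by inductive predicates \<open>chain X Y v\<close> and \<open>lifted \<Gamma> a b v\<close>, whose last argument is the
  total length of some chain or lift.
\<close>

section \<open>The weighted distance\<close>

lemma surj_rel_finite: "surj_rel R X Y \<Longrightarrow> X \<in> Ran M \<Longrightarrow> Y \<in> Ran M \<Longrightarrow> finite R"
  unfolding surj_rel_def Ran_def using finite_subset by blast

lemma surj_rel_nonempty: "surj_rel R X Y \<Longrightarrow> X \<in> Ran M \<Longrightarrow> R \<noteq> {}"
  unfolding surj_rel_def Ran_def by auto

lemma surj_rel_converse: "surj_rel R X Y \<Longrightarrow> surj_rel (R\<inverse>) Y X"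
  unfolding surj_rel_def by (auto simp: fst_eq_Domain snd_eq_Range)

lemma weight_ge_1: "weight \<omega> \<Longrightarrow> 1 \<le> n \<Longrightarrow> 1 \<le> \<omega> n"
  by (simp add: weight_def)

lemma weight_mono: "weight \<omega> \<Longrightarrow> 1 \<le> m \<Longrightarrow> m \<le> n \<Longrightarrow> \<omega> m \<le> \<omega> n"
  by (auto simp: weight_def mono_on_def)

locale weighted_metric_space = Metric_space M d for M :: "'a set" and d +
  fixes \<omega> :: "nat \<Rightarrow> real"
  assumes weight: "weight \<omega>"
begin

inductive chain :: "'a set \<Rightarrow> 'a set \<Rightarrow> real \<Rightarrow> bool" where
  chain_refl: "X \<in> Ran M \<Longrightarrow> chain X X 0"
| chain_step: "chain X Y v \<Longrightarrow> surj_rel R Y Z \<Longrightarrow> Z \<in> Ran M \<Longrightarrow> chain X Z (v + rel_length \<omega> d R)"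

lemma chain_Ran: "chain X Y v \<Longrightarrow> X \<in> Ran M \<and> Y \<in> Ran M"
  by (induction rule: chain.induct) auto

lemma comb_chain_imp_chain:
  "comb_chain M X Y k Z R \<Longrightarrow> chain X Y (\<Sum>j<k. rel_length \<omega> d (R j))"
proof (induction k arbitrary: Y)
  case 0
  then show ?case by (auto simp: comb_chain_def intro: chain_refl)
next
  case (Suc k)
  then have "comb_chain M X (Z k) k Z R" by (simp add: comb_chain_def)
  then have "chain X (Z k) (\<Sum>j<k. rel_length \<omega> d (R j))" by (rule Suc.IH)
  moreover have "surj_rel (R k) (Z k) Y" "Y \<in> Ran M"
    using Suc.prems by (auto simp: comb_chain_def)
  ultimately show ?case by (auto intro: chain_step)
qed

lemma chain_imp_comb_chain:
  "chain X Y v \<Longrightarrow> \<exists>k Z R. comb_chain M X Y k Z R \<and> v = (\<Sum>j<k. rel_length \<omega> d (R j))"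
proof (induction rule: chain.induct)
  case (chain_refl X)
  then have "comb_chain M X X 0 (\<lambda>_. X) (\<lambda>_. {})" by (simp add: comb_chain_def)
  then show ?case by force
next
  case (chain_step X Y v S Y')
  then obtain k Z R where c: "comb_chain M X Y k Z R" and v: "v = (\<Sum>j<k. rel_length \<omega> d (R j))"
    by blast
  have "comb_chain M X Y' (Suc k) (Z(Suc k := Y')) (R(k := S))"
    using c chain_step.hyps by (auto simp: comb_chain_def less_Suc_eq le_Suc_eq)
  moreover have "v + rel_length \<omega> d S = (\<Sum>j<Suc k. rel_length \<omega> d ((R(k := S)) j))"
    by (simp add: v)
  ultimately show ?case by blast
qed

lemma ran_dist_eq_Inf_chain:
  "X \<in> Ran M \<Longrightarrow> Y \<in> Ran M \<Longrightarrow> ran_dist \<omega> M d X Y = Inf {v. chain X Y v}"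
proof -
  have "{\<Sum>j<k. rel_length \<omega> d (R j) |k Z R. comb_chain M X Y k Z R} = {v. chain X Y v}"
    using comb_chain_imp_chain chain_imp_comb_chain by blast
  then show "X \<in> Ran M \<Longrightarrow> Y \<in> Ran M \<Longrightarrow> ?thesis" by (simp add: ran_dist_def)
qed

lemma sum_le_rel_length:
  assumes "surj_rel R X Y" "X \<in> Ran M" "Y \<in> Ran M"
  shows "(\<Sum>(x, y)\<in>R. d x y) \<le> rel_length \<omega> d R"
proof -
  have "1 \<le> card R"
    using surj_rel_finite[OF assms] surj_rel_nonempty[OF assms(1,2)]
    by (simp add: Suc_leI card_gt_0_iff)
  then have "1 \<le> \<omega> (card R)" by (rule weight_ge_1[OF weight])
  moreover have "0 \<le> (\<Sum>(x, y)\<in>R. d x y)" by (auto intro: sum_nonneg)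
  ultimately show ?thesis
    unfolding rel_length_def by (metis mult.left_neutral mult_right_mono)
qed

lemma dist_le_rel_length:
  assumes "surj_rel R X Y" "X \<in> Ran M" "Y \<in> Ran M" "(x, y) \<in> R"
  shows "d x y \<le> rel_length \<omega> d R"
proof -
  have "(\<lambda>(x, y). d x y) (x, y) \<le> (\<Sum>(x, y)\<in>R. d x y)"
    using surj_rel_finite[OF assms(1-3)] assms(4) by (intro member_le_sum) auto
  then show ?thesis using sum_le_rel_length[OF assms(1-3)] by simp
qed

lemma chain_nonneg: "chain X Y v \<Longrightarrow> 0 \<le> v"
proof (induction rule: chain.induct)
  case (chain_step X Y v R Z)
  have "0 \<le> (\<Sum>(x, y)\<in>R. d x y)" by (auto intro: sum_nonneg)
  then show ?case
    using sum_le_rel_length[of R Y Z] chain_step chain_Ran by fastforce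
qed simp

lemma chain_trans: "chain Y Z w \<Longrightarrow> chain X Y v \<Longrightarrow> chain X Z (v + w)"
proof (induction arbitrary: v rule: chain.induct)
  case (chain_step Y Z w R Z')
  then show ?case using chain.chain_step[of X Z "v + w" R Z'] by (simp add: add.assoc)
qed simp

lemma chain_single:
  "surj_rel R X Y \<Longrightarrow> X \<in> Ran M \<Longrightarrow> Y \<in> Ran M \<Longrightarrow> chain X Y (rel_length \<omega> d R)"
  using chain_step[OF chain_refl] by fastforce

lemma rel_length_converse: "rel_length \<omega> d (R\<inverse>) = rel_length \<omega> d R"
proof -
  have "(\<Sum>(x, y)\<in>R\<inverse>. d x y) = (\<Sum>(x, y)\<in>R. d x y)"
    by (rule sum.reindex_bij_witness[of _ "\<lambda>(x, y). (y, x)" "\<lambda>(x, y). (y, x)"])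
       (auto simp: commute)
  then show ?thesis by (simp add: rel_length_def)
qed

lemma chain_sym: "chain X Y v \<Longrightarrow> chain Y X v"
proof (induction rule: chain.induct)
  case (chain_step X Y v R Z)
  have "chain Z Y (rel_length \<omega> d (R\<inverse>))"
    using chain_step chain_Ran by (intro chain_single surj_rel_converse) auto
  from chain_trans[OF chain_step.IH this] show ?case
    by (simp add: rel_length_converse add.commute)
qed (rule chain_refl)

lemma chain_exists:
  assumes "X \<in> Ran M" "Y \<in> Ran M"
  shows "\<exists>v. chain X Y v"
proof -
  have "surj_rel (X \<times> Y) X Y"
    using assms by (simp add: surj_rel_def Ran_def fst_image_times snd_image_times)
  from chain_single[OF this assms] show ?thesis by (rule exI)
qed

text \<open>Because \<open>\<omega> \<ge> 1\<close>, a chain dominates the length of every sequence of points that it contains, and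
  surjectivity allows such a sequence to be traced back from any point of \<open>Y\<close>. Thus the weighted distance dominates
  the Hausdorff distance, which is why it separates finite sets.\<close>
lemma chain_point:
  "chain X Y v \<Longrightarrow> y \<in> Y \<Longrightarrow> \<exists>x\<in>X. d x y \<le> v"
proof (induction arbitrary: y rule: chain.induct)
  case (chain_refl X)
  then have "y \<in> M" by (auto simp: Ran_def)
  with chain_refl show ?case by force
next
  case (chain_step X Y v R Z)
  then have "y \<in> snd ` R" "R \<subseteq> Y \<times> Z" by (auto simp: surj_rel_def)
  then obtain y' where R: "(y', y) \<in> R" and y': "y' \<in> Y" by auto
  obtain x where x: "x \<in> X" "d x y' \<le> v" using chain_step.IH[OF y'] by blast
  have Ran: "X \<in> Ran M" "Y \<in> Ran M" using chain_Ran chain_step.hyps by auto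
  have "x \<in> M" "y' \<in> M" "y \<in> M"
    using x y' Ran chain_step by (auto simp: Ran_def)
  then have "d x y \<le> d x y' + d y' y" by (rule triangle)
  also have "\<dots> \<le> v + rel_length \<omega> d R"
    using dist_le_rel_length[OF _ _ _ R] x chain_step.hyps Ran by (meson add_mono)
  finally show ?case using x by blast
qed

lemma ran_dist_le: "chain X Y v \<Longrightarrow> ran_dist \<omega> M d X Y \<le> v"
  using chain_Ran chain_nonneg
  by (auto simp: ran_dist_eq_Inf_chain intro!: cInf_lower bdd_belowI[of _ 0])

lemma ran_dist_approx:
  assumes "X \<in> Ran M" "Y \<in> Ran M" "0 < e"
  shows "\<exists>v. chain X Y v \<and> v < ran_dist \<omega> M d X Y + e"
proof -
  have "{v. chain X Y v} \<noteq> {}" using chain_exists assms by blast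
  moreover have "Inf {v. chain X Y v} < ran_dist \<omega> M d X Y + e"
    using assms by (simp add: ran_dist_eq_Inf_chain)
  ultimately show ?thesis using cInf_lessD[of "{v. chain X Y v}"] by simp
qed

lemma ran_dist_ge: 
  "X \<in> Ran M \<Longrightarrow> Y \<in> Ran M \<Longrightarrow> (\<And>v. chain X Y v \<Longrightarrow> c \<le> v) \<Longrightarrow> c \<le> ran_dist \<omega> M d X Y"
  using chain_exists by (auto simp: ran_dist_eq_Inf_chain intro!: cInf_greatest)

lemma ran_dist_zero_subset:
  assumes "X \<in> Ran M" "Y \<in> Ran M" "ran_dist \<omega> M d X Y = 0"
  shows "Y \<subseteq> X"
proof (rule subsetI, rule ccontr)
  fix y assume y: "y \<in> Y" "y \<notin> X"
  have X: "finite X" "X \<noteq> {}" "X \<subseteq> M" and yM: "y \<in> M" using assms y by (auto simp: Ran_def)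
  define e where "e = Min ((\<lambda>x. d x y) ` X)"
  have "0 < e" using X yM y by (auto simp: e_def)
  then obtain v where v: "chain X Y v" "v < e" using ran_dist_approx[of X Y e] assms by auto
  then obtain x where "x \<in> X" "d x y \<le> v" using chain_point y by blast
  moreover have "e \<le> d x y" if "x \<in> X" for x using X that by (auto simp: e_def)
  ultimately show False using v by fastforce
qed

lemma ran_dist_commute: "ran_dist \<omega> M d X Y = ran_dist \<omega> M d Y X"
proof (cases "X \<in> Ran M \<and> Y \<in> Ran M")
  case True
  have "{v. chain X Y v} = {v. chain Y X v}"
    by (rule Collect_cong) (rule iffI; erule chain_sym)
  from arg_cong[OF this, of Inf] show ?thesis
    using True by (metis ran_dist_eq_Inf_chain)
qed (auto simp: ran_dist_def)

lemma ran_dist_nonneg: "0 \<le> ran_dist \<omega> M d X Y"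
proof (cases "X \<in> Ran M \<and> Y \<in> Ran M")
  case True
  then show ?thesis using chain_nonneg by (intro ran_dist_ge) auto
qed (auto simp: ran_dist_def)

lemma Metric_space_ran_dist: "Metric_space (Ran M) (ran_dist \<omega> M d)"
proof
  show "0 \<le> ran_dist \<omega> M d X Y" for X Y by (rule ran_dist_nonneg)
  show "ran_dist \<omega> M d X Y = ran_dist \<omega> M d Y X" for X Y by (rule ran_dist_commute)
  show "(ran_dist \<omega> M d X Y = 0) = (X = Y)" if "X \<in> Ran M" "Y \<in> Ran M" for X Y
  proof
    assume "ran_dist \<omega> M d X Y = 0"
    then show "X = Y"
      using ran_dist_zero_subset[OF that] ran_dist_zero_subset[OF that(2,1)] ran_dist_commute[of X Y]
      by simp
  next
    assume "X = Y"
    then show "ran_dist \<omega> M d X Y = 0"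
      using ran_dist_le[OF chain_refl[OF that(1)]] ran_dist_nonneg[of X X] by simp
  qed
  show "ran_dist \<omega> M d X Z \<le> ran_dist \<omega> M d X Y + ran_dist \<omega> M d Y Z"
    if XYZ: "X \<in> Ran M" "Y \<in> Ran M" "Z \<in> Ran M" for X Y Z
  proof (rule field_le_epsilon)
    fix e :: real assume "0 < e"
    then obtain v w where v: "chain X Y v" "v < ran_dist \<omega> M d X Y + e / 2"
      and w: "chain Y Z w" "w < ran_dist \<omega> M d Y Z + e / 2"
      using ran_dist_approx[OF XYZ(1,2), of "e / 2"] ran_dist_approx[OF XYZ(2,3), of "e / 2"]
      by auto
    show "ran_dist \<omega> M d X Z \<le> ran_dist \<omega> M d X Y + ran_dist \<omega> M d Y Z + e"
      using ran_dist_le[OF chain_trans[OF w(1) v(1)]] v(2) w(2) by simp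
  qed
qed

sublocale ran: Metric_space "Ran M" "ran_dist \<omega> M d"
  by (rule Metric_space_ran_dist)

end

section \<open>Subpaths of admissible paths\<close>

text \<open>Working with an unrestricted function and an interval avoids nested restrictions when
  paths are cut repeatedly.\<close>
abbreviation path_on :: "(real \<Rightarrow> 'a) \<Rightarrow> real \<Rightarrow> real \<Rightarrow> 'a ipath" where
  "path_on \<gamma> a b \<equiv> (a, b, restrict \<gamma> {a..b})"

context length_structure
begin

lemma path_on_eq: "(a, b, \<gamma>) \<in> P \<Longrightarrow> path_on \<gamma> a b = (a, b, \<gamma>)"
  using P_subset by (auto simp: cpaths_def extensional_restrict)

lemma P_cpaths: "p \<in> P \<Longrightarrow> p \<in> cpaths T"
  using P_subset by blast

lemma subpath_split:
  assumes "path_on \<gamma> a b \<in> P" "a \<le> c" "c \<le> b"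
  shows "path_on \<gamma> a c \<in> P" "path_on \<gamma> c b \<in> P" "L (path_on \<gamma> a b) = L (path_on \<gamma> a c) + L (path_on \<gamma> c b)"
proof -
  have r: "restrict (restrict \<gamma> {a..b}) {a..c} = restrict \<gamma> {a..c}"
    "restrict (restrict \<gamma> {a..b}) {c..b} = restrict \<gamma> {c..b}"
    using assms by (auto simp: fun_eq_iff)
  show "path_on \<gamma> a c \<in> P" "path_on \<gamma> c b \<in> P" 
    using P_split[OF P_cpaths[OF assms(1)], of c] assms by (auto simp: r)
  show "L (path_on \<gamma> a b) = L (path_on \<gamma> a c) + L (path_on \<gamma> c b)"
    using L_split[OF assms(1), of c] assms by (auto simp: r)
qed

lemma subpath:
  assumes "path_on \<gamma> a b \<in> P" "a \<le> s" "s \<le> t" "t \<le> b"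
  shows "path_on \<gamma> s t \<in> P"
  using subpath_split(1)[OF subpath_split(2)[OF assms(1), of s], of t] assms by simp

lemma subpath_length_le:
  assumes "path_on \<gamma> a b \<in> P" "a \<le> s" "s \<le> t" "t \<le> b"
  shows "L (path_on \<gamma> s t) \<le> L (path_on \<gamma> a b)"
proof -
  have "L (path_on \<gamma> a b) = L (path_on \<gamma> a s) + L (path_on \<gamma> s b)"
    using subpath_split(3)[OF assms(1)] assms by simp
  moreover have "L (path_on \<gamma> s b) = L (path_on \<gamma> s t) + L (path_on \<gamma> t b)"
    using subpath_split(3)[OF subpath_split(2)[OF assms(1), of s], of t] assms by simp
  moreover have "0 \<le> L (path_on \<gamma> a s)" "0 \<le> L (path_on \<gamma> t b)"
    using subpath[OF assms(1)] assms by (auto intro!: L_nonneg)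
  ultimately show ?thesis by linarith
qed

lemma length_degenerate:
  assumes "path_on \<gamma> a b \<in> P" "a \<le> b"
  shows "L (path_on \<gamma> a a) = 0"
  using subpath_split(3)[OF assms(1), of a] assms(2) by simp

lemma length_continuous:
  assumes "path_on \<gamma> a b \<in> P"
  shows "continuous_on {a..b} (\<lambda>t. L (path_on \<gamma> a t))"
proof -
  have "continuous_on {a..b} (\<lambda>t. L (path_on (restrict \<gamma> {a..b}) a t))"
    using L_continuous[OF assms] by simp
  moreover have "path_on (restrict \<gamma> {a..b}) a t = path_on \<gamma> a t" if "t \<in> {a..b}" for t
    using that by (auto simp: fun_eq_iff)
  ultimately show ?thesis by (subst (asm) continuous_on_cong[OF refl]) auto
qed

lemma reparametrise:
  fixes m q :: real
  assumes "path_on \<gamma> a b \<in> P" "m \<noteq> 0" "(\<lambda>s. m * s + q) ` {c..d} = {a..b}"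
  shows "path_on (\<lambda>s. \<gamma> (m * s + q)) c d \<in> P"
    and "L (path_on (\<lambda>s. \<gamma> (m * s + q)) c d) = L (path_on \<gamma> a b)"
proof -
  have h: "affine_homeo (\<lambda>s. m * s + q) c d a b"
    using assms(2,3) unfolding affine_homeo_def bij_betw_def inj_on_def by auto
  have e: "compose {c..d} (restrict \<gamma> {a..b}) (\<lambda>s. m * s + q) = restrict (\<lambda>s. \<gamma> (m * s + q)) {c..d}"
    using equalityD1[OF assms(3)] by (auto simp: compose_def fun_eq_iff image_subset_iff)
  show "path_on (\<lambda>s. \<gamma> (m * s + q)) c d \<in> P"
    using P_affine[OF P_cpaths[OF assms(1)] h] assms(1) by (simp add: e)
  show "L (path_on (\<lambda>s. \<gamma> (m * s + q)) c d) = L (path_on \<gamma> a b)"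
    using L_affine[OF assms(1) h] by (simp add: e)
qed

text \<open>The sign of the slope of the affine map takes care of the order of \<open>s\<close> and \<open>t\<close>, so
  admissible paths can be traversed backwards.\<close>
lemma reparametrise_between:
  assumes "path_on \<gamma> a b \<in> P" "s \<in> {a..b}" "t \<in> {a..b}" "s \<noteq> t" "c < d"
  shows "\<exists>\<eta>. path_on \<eta> c d \<in> P \<and> \<eta> c = \<gamma> s \<and> \<eta> d = \<gamma> t \<and> L (path_on \<eta> c d) \<le> L (path_on \<gamma> a b)"
proof -
  define m q where "m = (t - s) / (d - c)" and "q = s - m * c"
  have m: "m \<noteq> 0" using assms by (simp add: m_def)
  have c: "m * c + q = s" by (simp add: q_def)
  have "m * (d - c) = t - s" using assms by (simp add: m_def)
  then have d: "m * d + q = t" by (simp add: q_def algebra_simps)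
  have "m > 0 \<longleftrightarrow> s < t" using assms(5) by (simp add: m_def zero_less_divide_iff)
  then have im: "(\<lambda>u. m * u + q) ` {c..d} = {min s t..max s t}"
    using assms(4,5) m c d by (auto simp: image_affinity_atLeastAtMost min_def max_def)
  have sub: "path_on \<gamma> (min s t) (max s t) \<in> P"
    using assms by (intro subpath[OF assms(1)]) auto
  have "L (path_on \<gamma> (min s t) (max s t)) \<le> L (path_on \<gamma> a b)"
    using assms by (intro subpath_length_le[OF assms(1)]) auto
  then show ?thesis
    using reparametrise[OF sub m im] c d by (intro exI[of _ "\<lambda>u. \<gamma> (m * u + q)"]) auto
qed

end

section \<open>Almost shortest paths in a length space\<close>

context length_space
begin

abbreviation d :: "'a \<Rightarrow> 'a \<Rightarrow> real" where "d \<equiv> length_dist P L"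

sublocale Metric_space "topspace T" d
  by (rule metric)

lemma length_edist_nonneg: "0 \<le> length_edist P L x y"
  unfolding length_edist_def by (rule Inf_greatest) (auto simp: L_nonneg)

lemma ereal_dist:
  assumes "x \<in> topspace T" "y \<in> topspace T"
  shows "ereal (d x y) = length_edist P L x y"
proof -
  have "\<bar>length_edist P L x y\<bar> \<noteq> \<infinity>" 
    using finite_edist[OF assms] length_edist_nonneg[of x y] by (cases "length_edist P L x y") auto
  then show ?thesis by (simp add: length_dist_def ereal_real')
qed

lemma path_on_in_space:
  assumes "path_on \<gamma> a b \<in> P" "s \<in> {a..b}"
  shows "\<gamma> s \<in> topspace T"
  using P_cpaths[OF assms(1)] assms(2) by (auto simp: cpaths_def continuous_map_def Pi_iff)

lemma dist_le_length:
  assumes "path_on \<gamma> a b \<in> P" "a \<le> b"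
  shows "d (\<gamma> a) (\<gamma> b) \<le> L (path_on \<gamma> a b)"
proof -
  have "length_edist P L (\<gamma> a) (\<gamma> b) \<le> ereal (L (path_on \<gamma> a b))"
    unfolding length_edist_def
  proof (rule Inf_lower, rule CollectI, intro exI conjI)
    show "path_on \<gamma> a b \<in> P" by (rule assms(1))
    show "\<gamma> a \<in> restrict \<gamma> {a..b} ` {a..b}" "\<gamma> b \<in> restrict \<gamma> {a..b} ` {a..b}"
      using assms(2) by auto
  qed (rule refl)
  then show ?thesis
    using ereal_dist[of "\<gamma> a" "\<gamma> b"] path_on_in_space[OF assms(1)] assms(2) by (metis atLeastAtMost_iff ereal_less_eq(3) order_refl)
qed

lemma short_path_distinct:
  assumes "x \<in> topspace T" "y \<in> topspace T" "x \<noteq> y" "c < c'" "0 < e"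
  shows "\<exists>\<eta>. path_on \<eta> c c' \<in> P \<and> \<eta> c = x \<and> \<eta> c' = y \<and> L (path_on \<eta> c c') \<le> d x y + e"
proof -
  have "length_edist P L x y < ereal (d x y + e)"
    using ereal_dist[OF assms(1,2)] assms(5) by (metis ereal_less_le less_add_same_cancel1 less_ereal.simps(1))
  then obtain a b \<gamma> where g: "(a, b, \<gamma>) \<in> P" "x \<in> \<gamma> ` {a..b}" "y \<in> \<gamma> ` {a..b}" "L (a, b, \<gamma>) < d x y + e"
    unfolding length_edist_def Inf_less_iff by auto
  then obtain s t where st: "s \<in> {a..b}" "t \<in> {a..b}" "\<gamma> s = x" "\<gamma> t = y" by auto
  have "path_on \<gamma> a b \<in> P" "L (path_on \<gamma> a b) < d x y + e" using g by (simp_all only: path_on_eq[OF g(1)])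
  with reparametrise_between[of a b \<gamma> s t c c'] st assms(3,4) show ?thesis by force
qed

text \<open>This takes the place of the constant path at \<open>x\<close>, which need not be admissible. By continuity
  of the length, a short enough initial part of a path from \<open>x\<close> to \<open>y\<close> has length below \<open>e/2\<close>.\<close>
lemma short_loop:
  assumes "x \<in> topspace T" "y \<in> topspace T" "x \<noteq> y" "c < c'" "0 < e"
  shows "\<exists>\<eta>. path_on \<eta> c c' \<in> P \<and> \<eta> c = x \<and> \<eta> c' = x \<and> L (path_on \<eta> c c') \<le> e"
proof -
  obtain \<gamma> where g: "path_on \<gamma> 0 1 \<in> P" "\<gamma> 0 = x"
    using short_path_distinct[of x y 0 1 1] assms by auto
  have "continuous_on {0..1} (\<lambda>t. L (path_on \<gamma> 0 t))" using length_continuous[OF g(1)] .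
  then obtain r where r: "0 < r" "\<And>t. t \<in> {0..1} \<Longrightarrow> dist t 0 < r \<Longrightarrow> 
      dist (L (path_on \<gamma> 0 t)) (L (path_on \<gamma> 0 0)) < e / 2"
    using assms(5) unfolding continuous_on_iff by (metis atLeastAtMost_iff half_gt_zero order_refl zero_le_one)
  define t where "t = min 1 (r / 2)"
  have t: "0 < t" "t \<le> 1" "dist t 0 < r" using r(1) by (auto simp: t_def)
  have gt: "path_on \<gamma> 0 t \<in> P" using subpath[OF g(1), of 0 t] t by simp
  have Lt: "L (path_on \<gamma> 0 t) < e / 2" using r(2)[of t] t length_degenerate[OF g(1)] by (auto simp: dist_real_def)
  \<comment> \<open>Folding the interval at \<open>t\<close> makes the loop a composition, so its continuity is immediate.\<close>
  define \<eta> where "\<eta> u = \<gamma> (t - \<bar>u - t\<bar>)" for u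
  have out: "path_on \<eta> 0 t = path_on \<gamma> 0 t"
    by (auto simp: \<eta>_def fun_eq_iff)
  have inw: "path_on \<eta> t (2 * t) = path_on (\<lambda>u. \<gamma> ((-1) * u + 2 * t)) t (2 * t)"
    by (auto simp: \<eta>_def fun_eq_iff)
  have im: "(\<lambda>u. (-1) * u + 2 * t) ` {t..2 * t} = {0..t}"
    using t by (subst image_affinity_atLeastAtMost) auto
  have ret: "path_on \<eta> t (2 * t) \<in> P" "L (path_on \<eta> t (2 * t)) = L (path_on \<gamma> 0 t)"
    unfolding inw using reparametrise[OF gt _ im] by simp_all
  have "continuous_map (top_of_set {0..2 * t}) (top_of_set {0..t}) (\<lambda>u. t - \<bar>u - t\<bar>)"
    by (auto intro!: continuous_intros)
  moreover have "continuous_map (top_of_set {0..t}) T \<gamma>"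
    using P_cpaths[OF gt] unfolding cpaths_def by (auto elim: continuous_map_eq)
  ultimately have "continuous_map (top_of_set {0..2 * t}) T (\<gamma> \<circ> (\<lambda>u. t - \<bar>u - t\<bar>))"
    by (rule continuous_map_compose)
  then have "continuous_map (top_of_set {0..2 * t}) T (restrict \<eta> {0..2 * t})"
    by (rule continuous_map_eq) (simp add: \<eta>_def)
  then have cont: "path_on \<eta> 0 (2 * t) \<in> cpaths T"
    using t by (simp add: cpaths_def)
  have rr: "restrict (restrict \<eta> {0..2 * t}) {0..t} = restrict \<eta> {0..t}"
    "restrict (restrict \<eta> {0..2 * t}) {t..2 * t} = restrict \<eta> {t..2 * t}"
    using t by (auto simp: fun_eq_iff)
  have loop: "path_on \<eta> 0 (2 * t) \<in> P"
    using P_split[OF cont, of t] t gt ret(1) by (auto simp: rr out)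
  have "L (path_on \<eta> 0 (2 * t)) \<le> e"
    using subpath_split(3)[OF loop, of t] t ret(2) Lt by (simp add: out)
  moreover have "\<eta> 0 = x" "\<eta> (2 * t) = x" using t g(2) by (auto simp: \<eta>_def)
  ultimately show ?thesis
    using reparametrise_between[OF loop, of 0 "2 * t" c c'] t assms(4) by auto
qed

lemma short_path:
  assumes "x \<in> topspace T" "y \<in> topspace T" "\<not> topspace T \<subseteq> {x}" "c < c'" "0 < e"
  shows "\<exists>\<eta>. path_on \<eta> c c' \<in> P \<and> \<eta> c = x \<and> \<eta> c' = y \<and> L (path_on \<eta> c c') \<le> d x y + e"
proof (cases "x = y")
  case True
  obtain z where "z \<in> topspace T" "x \<noteq> z" using assms(3) by blast
  then show ?thesis using short_loop[of x z c c' e] True assms by auto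
next
  case False
  then show ?thesis using short_path_distinct assms by blast
qed

end


section \<open>Paths of finite subsets\<close>

locale weighted_length_space = length_space T P L
  for T :: "'a topology" and P :: "'a ipath set" and L :: "'a ipath \<Rightarrow> real" +
  fixes \<omega> :: "nat \<Rightarrow> real"
  assumes weight: "weight \<omega>"
begin

sublocale weighted_metric_space "topspace T" d \<omega>
  by unfold_locales (rule weight)

abbreviation Fin :: "'a set set" where "Fin \<equiv> Ran (topspace T)"

abbreviation D :: "'a set \<Rightarrow> 'a set \<Rightarrow> real" where "D \<equiv> ran_dist \<omega> (topspace T) d"

definition lift_piece :: "(real \<Rightarrow> 'a set) \<Rightarrow> real \<Rightarrow> real \<Rightarrow> nat \<Rightarrow> (nat \<Rightarrow> real \<Rightarrow> 'a) \<Rightarrow> bool" where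
  "lift_piece \<Gamma> c b n p \<longleftrightarrow> c < b \<and> 1 \<le> n \<and> (\<forall>j<n. path_on (p j) c b \<in> P) \<and>
     (\<forall>s\<in>{c..b}. (\<lambda>j. p j s) ` {..<n} = \<Gamma> s)"

definition piece_length :: "real \<Rightarrow> real \<Rightarrow> nat \<Rightarrow> (nat \<Rightarrow> real \<Rightarrow> 'a) \<Rightarrow> real" where
  "piece_length c b n p = \<omega> n * (\<Sum>j<n. L (path_on (p j) c b))"

text \<open>The condition in the base case matters only for degenerate intervals: the subdivision
  \<open>k = 0\<close> imposes nothing on \<open>\<Gamma> a\<close>.\<close>
inductive lifted :: "(real \<Rightarrow> 'a set) \<Rightarrow> real \<Rightarrow> real \<Rightarrow> real \<Rightarrow> bool" for \<Gamma> where
  lifted_refl: "\<Gamma> a \<in> Fin \<Longrightarrow> lifted \<Gamma> a a 0"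
| lifted_snoc: "lifted \<Gamma> a c v \<Longrightarrow> lift_piece \<Gamma> c b n p \<Longrightarrow> lifted \<Gamma> a b (v + piece_length c b n p)"

lemma lift_piece_sub:
  assumes "lift_piece \<Gamma> c b n p" "c \<le> s" "s < t" "t \<le> b"
  shows "lift_piece \<Gamma> s t n p"
  using assms subpath[of c b _ s t] by (auto simp: lift_piece_def)

lemma piece_length_add:
  assumes "lift_piece \<Gamma> c b n p" "c \<le> s" "s \<le> t" "t \<le> b"
  shows "piece_length c t n p = piece_length c s n p + piece_length s t n p"
proof -
  have "L (path_on (p j) c t) = L (path_on (p j) c s) + L (path_on (p j) s t)" if "j < n" for j
  proof (rule subpath_split(3))
    show "path_on (p j) c t \<in> P" using assms that by (auto simp: lift_piece_def intro: subpath[of c b "p j" c t])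
  qed (use assms in auto)
  then have "(\<Sum>j<n. L (path_on (p j) c t)) = (\<Sum>j<n. L (path_on (p j) c s) + L (path_on (p j) s t))"
    by (intro sum.cong) auto
  then show ?thesis by (simp add: piece_length_def sum.distrib distrib_left)
qed

lemma piece_length_degenerate: "lift_piece \<Gamma> c b n p \<Longrightarrow> piece_length c c n p = 0"
  using piece_length_add[of \<Gamma> c b n p c c] by (simp add: lift_piece_def)

lemma piece_length_nonneg: "lift_piece \<Gamma> c b n p \<Longrightarrow> 0 \<le> piece_length c b n p"
  using weight_ge_1[OF weight, of n]
  by (auto simp: piece_length_def lift_piece_def intro!: mult_nonneg_nonneg sum_nonneg L_nonneg)

lemma piece_length_continuous:
  assumes "lift_piece \<Gamma> c b n p"
  shows "continuous_on {c..b} (\<lambda>t. piece_length c t n p)"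
  using assms unfolding piece_length_def lift_piece_def
  by (intro continuous_on_mult continuous_on_const continuous_on_sum length_continuous) auto

lemma lift_piece_Fin:
  assumes "lift_piece \<Gamma> c b n p" "s \<in> {c..b}"
  shows "\<Gamma> s \<in> Fin"
proof -
  have "\<Gamma> s = (\<lambda>j. p j s) ` {..<n}" "{..<n} \<noteq> {}" 
    using assms by (auto simp: lift_piece_def lessThan_empty_iff)
  moreover have "p j s \<in> topspace T" if "j < n" for j
    using assms that by (auto simp: lift_piece_def intro: path_on_in_space[of c b])
  ultimately show ?thesis by (auto simp: Ran_def)
qed

text \<open>Coordinates with the same pair of endpoints collapse to a single pair of the relation, which
  lowers both its cardinality, hence the weight, and the sum of distances.\<close>
lemma dist_le_piece_length:
  assumes "lift_piece \<Gamma> c b n p"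
  shows "D (\<Gamma> c) (\<Gamma> b) \<le> piece_length c b n p"
proof -
  define R where "R = (\<lambda>j. (p j c, p j b)) ` {..<n}"
  have cb: "c < b" and n: "1 \<le> n" and adm: "\<And>j. j < n \<Longrightarrow> path_on (p j) c b \<in> P"
    using assms by (auto simp: lift_piece_def)
  have G: "\<Gamma> c = (\<lambda>j. p j c) ` {..<n}" "\<Gamma> b = (\<lambda>j. p j b) ` {..<n}"
    using assms by (auto simp: lift_piece_def)
  have R: "surj_rel R (\<Gamma> c) (\<Gamma> b)"
    unfolding surj_rel_def R_def G by (auto simp: image_image)
  have Fin: "\<Gamma> c \<in> Fin" "\<Gamma> b \<in> Fin" using lift_piece_Fin[OF assms] cb by auto
  have "1 \<le> card R"
    using surj_rel_finite[OF R Fin] surj_rel_nonempty[OF R Fin(1)] by (simp add: Suc_leI card_gt_0_iff)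
  moreover have "card R \<le> n"
    unfolding R_def using card_image_le[of "{..<n}" "\<lambda>j. (p j c, p j b)"] by simp
  ultimately have w: "\<omega> (card R) \<le> \<omega> n" by (rule weight_mono[OF weight])
  have "(\<Sum>(x, y)\<in>R. d x y) \<le> (\<Sum>j<n. d (p j c) (p j b))"
    unfolding R_def using sum_image_le[of "{..<n}" "\<lambda>(x, y). d x y" "\<lambda>j. (p j c, p j b)"]
    by (simp add: o_def)
  also have "\<dots> \<le> (\<Sum>j<n. L (path_on (p j) c b))"
    using cb by (intro sum_mono dist_le_length adm) auto
  finally have "rel_length \<omega> d R \<le> piece_length c b n p"
    unfolding rel_length_def piece_length_def
    using w weight_ge_1[OF weight n] by (intro mult_mono) (auto intro: sum_nonneg)
  then show ?thesis using ran_dist_le[OF chain_single[OF R Fin]] by linarith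
qed

lemma lifted_single: "lift_piece \<Gamma> c b n p \<Longrightarrow> lifted \<Gamma> c b (piece_length c b n p)"
  using lifted_snoc[OF lifted_refl] lift_piece_Fin[of \<Gamma> c b n p c] by (fastforce simp: lift_piece_def)

lemma lifted_le: "lifted \<Gamma> a b v \<Longrightarrow> a \<le> b"
  by (induction rule: lifted.induct) (auto simp: lift_piece_def)

lemma lifted_nonneg: "lifted \<Gamma> a b v \<Longrightarrow> 0 \<le> v"
  by (induction rule: lifted.induct) (auto simp: piece_length_nonneg)

lemma lifted_trans: "lifted \<Gamma> c b w \<Longrightarrow> lifted \<Gamma> a c v \<Longrightarrow> lifted \<Gamma> a b (v + w)"
proof (induction rule: lifted.induct)
  case (lifted_snoc c' c'' w b n p)
  then show ?case using lifted.lifted_snoc[of \<Gamma> a c'' "v + w" b n p] by (simp add: add.assoc)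
qed simp

lemma lifted_cong:
  "lifted \<Gamma> a b v \<Longrightarrow> (\<And>s. s \<in> {a..b} \<Longrightarrow> \<Gamma> s = \<Gamma>' s) \<Longrightarrow> lifted \<Gamma>' a b v"
proof (induction rule: lifted.induct)
  case (lifted_refl a)
  then show ?case by (auto intro: lifted.lifted_refl)
next
  case (lifted_snoc a c v b n p)
  have "a \<le> c" "c < b" using lifted_le lifted_snoc.hyps by (auto simp: lift_piece_def)
  then have "lifted \<Gamma>' a c v" "lift_piece \<Gamma>' c b n p" 
    using lifted_snoc by (auto simp: lift_piece_def)
  then show ?case by (rule lifted.lifted_snoc)
qed

lemma lifted_path_on: "lifted (restrict \<Gamma> {a..b}) a b v \<longleftrightarrow> lifted \<Gamma> a b v"
  by (auto elim: lifted_cong)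

text \<open>\<open>F t\<close> is the length of the part of a fixed lift that lies over \<open>[a,t]\<close>; it is continuous since
  the lengths of the coordinates are.\<close>
lemma lifted_arclength:
  "lifted \<Gamma> a b v \<Longrightarrow> \<exists>F. continuous_on {a..b} F \<and> F a = 0 \<and> F b = v \<and>
     (\<forall>s t. a \<le> s \<longrightarrow> s \<le> t \<longrightarrow> t \<le> b \<longrightarrow> lifted \<Gamma> s t (F t - F s))"
proof (induction rule: lifted.induct)
  case (lifted_refl a)
  then have "lifted \<Gamma> s t 0" if "a \<le> s" "s \<le> t" "t \<le> a" for s t
    using that lifted.lifted_refl[of \<Gamma> a] by (metis order_antisym order_trans)
  then show ?case by (intro exI[of _ "\<lambda>_. 0"]) simp
next
  case (lifted_snoc a c v b n p)
  note piece = lifted_snoc.hyps(2)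
  have ac: "a \<le> c" and cb: "c < b" using lifted_le lifted_snoc.hyps by (auto simp: lift_piece_def)
  obtain F where F: "continuous_on {a..c} F" "F a = 0" "F c = v"
    and sub: "\<And>s t. a \<le> s \<Longrightarrow> s \<le> t \<Longrightarrow> t \<le> c \<Longrightarrow> lifted \<Gamma> s t (F t - F s)"
    using lifted_snoc.IH by blast
  define H where "H t = (if t \<le> c then F t else v + piece_length c t n p)" for t
  have Hc: "H t = v + piece_length c t n p" if "c \<le> t" for t
    using that F(3) piece_length_degenerate[OF piece] by (auto simp: H_def)
  have "continuous_on {a..b} H"
    unfolding H_def
  proof (rule continuous_on_cases_le)
    have "{t \<in> {a..b}. t \<le> c} = {a..c}" using cb by auto
    then show "continuous_on {t \<in> {a..b}. t \<le> c} F" using F(1) by simp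
    have "{t \<in> {a..b}. c \<le> t} = {c..b}" using ac by auto
    then show "continuous_on {t \<in> {a..b}. c \<le> t} (\<lambda>t. v + piece_length c t n p)"
      using piece_length_continuous[OF piece] by (auto intro: continuous_on_add continuous_on_const)
    show "continuous_on {a..b} (\<lambda>t. t)" by (rule continuous_on_id)
  qed (use F(3) piece_length_degenerate[OF piece] in auto)
  moreover have tail: "lifted \<Gamma> s t (H t - H s)" if "c \<le> s" "s \<le> t" "t \<le> b" for s t
  proof (cases "s = t")
    case True
    then show ?thesis using lift_piece_Fin[OF piece, of t] that by (auto intro: lifted.lifted_refl)
  next
    case False
    then have "lift_piece \<Gamma> s t n p" using that by (intro lift_piece_sub[OF piece]) auto
    moreover have "H t - H s = piece_length s t n p"
      using that Hc[of s] Hc[of t] piece_length_add[OF piece, of s t] by simp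
    ultimately show ?thesis using lifted_single by simp
  qed
  moreover have "lifted \<Gamma> s t (H t - H s)" if "a \<le> s" "s \<le> t" "t \<le> b" for s t
  proof -
    consider "t \<le> c" | "c \<le> s" | "s \<le> c" "c \<le> t" by linarith
    then show ?thesis
    proof cases
      case 1
      then show ?thesis using sub that by (simp add: H_def)
    next
      case 2
      then show ?thesis using tail that by simp
    next
      case 3
      then have "lifted \<Gamma> s t ((F c - F s) + (H t - H c))"
        using that by (intro lifted_trans[OF tail sub]) auto
      then show ?thesis using 3 by (simp add: H_def)
    qed
  qed
  ultimately show ?case
    using F(2) ac Hc[of b] cb by (intro exI[of _ H]) (auto simp: H_def)
qed

lemma lifted_subinterval:
  "lifted \<Gamma> a b v \<Longrightarrow> a \<le> s \<Longrightarrow> s \<le> t \<Longrightarrow> t \<le> b \<Longrightarrow> \<exists>w. lifted \<Gamma> s t w"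
  using lifted_arclength by blast

lemma lifted_split:
  assumes "lifted \<Gamma> a b v" "a \<le> c" "c \<le> b"
  shows "\<exists>u w. lifted \<Gamma> a c u \<and> lifted \<Gamma> c b w \<and> v = u + w"
proof -
  obtain F where "F a = 0" "F b = v"
    "\<And>s t. a \<le> s \<Longrightarrow> s \<le> t \<Longrightarrow> t \<le> b \<Longrightarrow> lifted \<Gamma> s t (F t - F s)"
    using lifted_arclength[OF assms(1)] by blast
  then have "lifted \<Gamma> a c (F c)" "lifted \<Gamma> c b (v - F c)" using assms(2,3) by fastforce+
  then show ?thesis by force
qed

lemma lifted_dist:
  "lifted \<Gamma> a b v \<Longrightarrow> \<Gamma> a \<in> Fin \<and> \<Gamma> b \<in> Fin \<and> D (\<Gamma> a) (\<Gamma> b) \<le> v"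
proof (induction rule: lifted.induct)
  case (lifted_refl a)
  then show ?case by simp
next
  case (lifted_snoc a c v b n p)
  have "\<Gamma> b \<in> Fin" using lift_piece_Fin[OF lifted_snoc.hyps(2)] lifted_snoc.hyps(2) by (simp add: lift_piece_def)
  then show ?case
    using ran.triangle[of "\<Gamma> a" "\<Gamma> c" "\<Gamma> b"] dist_le_piece_length[OF lifted_snoc.hyps(2)] lifted_snoc.IH
    by auto
qed

lemma lifted_Fin:
  assumes "lifted \<Gamma> a b v" "s \<in> {a..b}"
  shows "\<Gamma> s \<in> Fin"
  using lifted_subinterval[OF assms(1), of s s] assms(2) lifted_dist by auto

text \<open>The distance of \<open>\<Gamma> s\<close> and \<open>\<Gamma> t\<close> is at most \<open>\<bar>F t - F s\<bar>\<close>, with \<open>F\<close> the arclength of a lift.\<close>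
lemma lifted_continuous:
  assumes "lifted \<Gamma> a b v"
  shows "continuous_map (top_of_set {a..b}) ran.mtopology \<Gamma>"
  unfolding ran.continuous_map_to_metric
proof (intro ballI allI impI)
  fix x and e :: real assume "x \<in> topspace (top_of_set {a..b})" and e: "0 < e"
  then have x: "x \<in> {a..b}" by simp
  obtain F where F: "continuous_on {a..b} F"
    and sub: "\<And>s t. a \<le> s \<Longrightarrow> s \<le> t \<Longrightarrow> t \<le> b \<Longrightarrow> lifted \<Gamma> s t (F t - F s)"
    using lifted_arclength[OF assms] by blast
  obtain r where r: "0 < r" "\<And>y. y \<in> {a..b} \<Longrightarrow> dist y x < r \<Longrightarrow> dist (F y) (F x) < e"
    using F x e unfolding continuous_on_iff by blast
  have "\<Gamma> y \<in> ran.mball (\<Gamma> x) e" if y: "y \<in> {a..b}" "dist y x < r" for y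
  proof -
    have "D (\<Gamma> x) (\<Gamma> y) \<le> \<bar>F y - F x\<bar>"
    proof (cases "x \<le> y")
      case True
      then show ?thesis using lifted_dist[OF sub[of x y]] x y by auto
    next
      case False
      then show ?thesis using lifted_dist[OF sub[of y x]] x y ran.commute[of "\<Gamma> x" "\<Gamma> y"] by auto
    qed
    also have "\<dots> < e" using r(2)[OF y] by (simp add: dist_real_def)
    finally show ?thesis using lifted_Fin[OF assms] x y by (simp add: ran.in_mball)
  qed
  then show "\<exists>U. openin (top_of_set {a..b}) U \<and> x \<in> U \<and> (\<forall>y\<in>U. \<Gamma> y \<in> ran.mball (\<Gamma> x) e)"
    using x r(1) by (intro exI[of _ "{a..b} \<inter> ball x r"]) (auto simp: openin_open_Int dist_commute)
qed

section \<open>Lifts with explicit subdivisions\<close>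

lemma lifted_imp_admissible_lift:
  "lifted \<Gamma> a b v \<Longrightarrow> \<exists>k t n g. admissible_lift T P (a, b, \<Gamma>) k t n g \<and> v = lift_length \<omega> L k t n g"
proof (induction rule: lifted.induct)
  case (lifted_refl a)
  have "admissible_lift T P (a, a, \<Gamma>) 0 (\<lambda>_. a) (\<lambda>_. 1) (\<lambda>_ _ _. undefined)"
    by (simp add: admissible_lift_def is_lift_def)
  then show ?case by (force simp: lift_length_def)
next
  case (lifted_snoc a c v b m p)
  then obtain k t n g where adm: "admissible_lift T P (a, c, \<Gamma>) k t n g"
    and v: "v = lift_length \<omega> L k t n g" by blast
  have tk: "t k = c" using adm by (auto simp: admissible_lift_def is_lift_def)
  have cb: "c < b" and m: "1 \<le> m" and P: "\<And>j. j < m \<Longrightarrow> path_on (p j) c b \<in> P"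
    and \<Gamma>: "\<And>s. s \<in> {c..b} \<Longrightarrow> (\<lambda>j. p j s) ` {..<m} = \<Gamma> s"
    using lifted_snoc.hyps(2) by (auto simp: lift_piece_def)
  define h where "h = restrict (\<lambda>s. restrict (\<lambda>j. p j s) {..<m}) {c..b}"
  define t' n' g' where "t' = t(Suc k := b)" and "n' = n(k := m)" and "g' = g(k := h)"
  have old: "t' i = t i" "t' (Suc i) = t (Suc i)" "n' i = n i" "g' i = g i" if "i < k" for i
    using that by (auto simp: t'_def n'_def g'_def)
  have new: "t' k = c" "t' (Suc k) = b" "n' k = m" "g' k = h" 
    by (auto simp: t'_def n'_def g'_def tk)
  have old_path: "coord_path t' g' i j = coord_path t g i j" if "i < k" for i j
    using old[OF that] by (simp add: coord_path_def)
  have new_path: "coord_path t' g' k j = path_on (p j) c b" if "j < m" for j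
    using that by (auto simp: coord_path_def new h_def fun_eq_iff)
  have "continuous_map (top_of_set {c..b}) (product_topology (\<lambda>_. T) {..<m}) h"
    unfolding continuous_map_componentwise
  proof (intro conjI ballI)
    show "h ` topspace (top_of_set {c..b}) \<subseteq> extensional {..<m}"
      by (auto simp: h_def)
    fix j assume "j \<in> {..<m}"
    then have j: "j < m" by simp
    then have "continuous_map (top_of_set {c..b}) T (restrict (p j) {c..b})"
      using P_cpaths[OF P[OF j]] by (simp add: cpaths_def)
    then show "continuous_map (top_of_set {c..b}) T (\<lambda>s. h s j)"
      by (rule continuous_map_eq) (use j in \<open>auto simp: h_def\<close>)
  qed
  then have "(c, b, h) \<in> cpaths (product_topology (\<lambda>_. T) {..<m})"
    using cb by (auto simp: cpaths_def h_def)
  moreover have "coord_set m (h s) = \<Gamma> s" if "s \<in> {c..b}" for s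
    using \<Gamma>[OF that] that by (simp add: coord_set_def h_def)
  ultimately have "admissible_lift T P (a, b, \<Gamma>) (Suc k) t' n' g'"
    using adm cb m P old new old_path new_path
    unfolding admissible_lift_def is_lift_def
    by (auto simp: less_Suc_eq t'_def)
  moreover have "v + piece_length c b m p = lift_length \<omega> L (Suc k) t' n' g'"
    by (simp add: v lift_length_def piece_length_def old old_path new new_path)
  ultimately show ?case by blast
qed

lemma admissible_lift_imp_lifted:
  "admissible_lift T P (a, b, \<Gamma>) k t n g \<Longrightarrow> \<Gamma> a \<in> Fin \<Longrightarrow> lifted \<Gamma> a b (lift_length \<omega> L k t n g)"
proof (induction k arbitrary: b)
  case 0
  then show ?case by (auto simp: admissible_lift_def is_lift_def lift_length_def intro: lifted_refl)
next
  case (Suc k)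
  have "admissible_lift T P (a, t k, \<Gamma>) k t n g"
    using Suc.prems(1) by (auto simp: admissible_lift_def is_lift_def)
  then have IH: "lifted \<Gamma> a (t k) (lift_length \<omega> L k t n g)" by (rule Suc.IH[OF _ Suc.prems(2)])
  have b: "t (Suc k) = b" using Suc.prems(1) by (simp add: admissible_lift_def is_lift_def)
  have "lift_piece \<Gamma> (t k) b (n k) (\<lambda>j s. g k s j)"
    using Suc.prems(1) by (auto simp: admissible_lift_def is_lift_def lift_piece_def coord_path_def coord_set_def)
  from lifted_snoc[OF IH this] show ?case
    by (simp add: lift_length_def piece_length_def coord_path_def b)
qed

lemma ran_topology_eq: "ran_topology \<omega> (topspace T) d = ran.mtopology"
  by (simp add: ran_topology_def)

text \<open>The continuity required of an admissible path comes from the lift, by \<open>lifted_continuous\<close>.\<close>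
lemma ran_paths_iff: 
  "(a, b, \<Gamma>) \<in> ran_paths \<omega> T P L \<longleftrightarrow> \<Gamma> \<in> extensional {a..b} \<and> (\<exists>v. lifted \<Gamma> a b v)"
proof
  assume r: "(a, b, \<Gamma>) \<in> ran_paths \<omega> T P L"
  then have "\<Gamma> a \<in> Fin" "\<Gamma> \<in> extensional {a..b}"
    by (auto simp: ran_paths_def cpaths_def ran_topology_eq continuous_map_def Pi_iff)
  with r show "\<Gamma> \<in> extensional {a..b} \<and> (\<exists>v. lifted \<Gamma> a b v)"
    using admissible_lift_imp_lifted unfolding ran_paths_def by blast
next
  assume "\<Gamma> \<in> extensional {a..b} \<and> (\<exists>v. lifted \<Gamma> a b v)"
  then obtain v where v: "\<Gamma> \<in> extensional {a..b}" "lifted \<Gamma> a b v" by blast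
  then have "(a, b, \<Gamma>) \<in> cpaths ran.mtopology"
    using lifted_le lifted_continuous by (auto simp: cpaths_def)
  then show "(a, b, \<Gamma>) \<in> ran_paths \<omega> T P L"
    using lifted_imp_admissible_lift[OF v(2)] by (auto simp: ran_paths_def ran_topology_eq)
qed

lemma ran_paths_path_on: "path_on \<Gamma> a b \<in> ran_paths \<omega> T P L \<longleftrightarrow> (\<exists>v. lifted \<Gamma> a b v)"
  by (simp add: ran_paths_iff lifted_path_on)

lemma ran_paths_restrict: "(a, b, \<Gamma>) \<in> ran_paths \<omega> T P L \<Longrightarrow> (a, b, \<Gamma>) = path_on \<Gamma> a b"
  by (simp add: ran_paths_iff extensional_restrict)

abbreviation len :: "(real \<Rightarrow> 'a set) \<Rightarrow> real \<Rightarrow> real \<Rightarrow> real" where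
  "len \<Gamma> a b \<equiv> ran_length \<omega> T P L (path_on \<Gamma> a b)"

lemma len_eq_Inf:
  assumes "lifted \<Gamma> a b v"
  shows "len \<Gamma> a b = Inf {v. lifted \<Gamma> a b v}"
proof -
  have "restrict \<Gamma> {a..b} a \<in> Fin" using lifted_dist[OF assms] lifted_le[OF assms] by simp
  then have "{lift_length \<omega> L k t n g |k t n g. admissible_lift T P (path_on \<Gamma> a b) k t n g} =
    {v. lifted (restrict \<Gamma> {a..b}) a b v}"
    using admissible_lift_imp_lifted lifted_imp_admissible_lift by blast
  then show ?thesis by (simp add: ran_length_def lifted_path_on)
qed

lemma len_le: "lifted \<Gamma> a b v \<Longrightarrow> len \<Gamma> a b \<le> v"
  by (auto simp: len_eq_Inf intro!: cInf_lower bdd_belowI[of _ 0] lifted_nonneg)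

lemma len_ge:
  assumes "lifted \<Gamma> a b v" "\<And>w. lifted \<Gamma> a b w \<Longrightarrow> u \<le> w"
  shows "u \<le> len \<Gamma> a b"
  unfolding len_eq_Inf[OF assms(1)] using assms by (intro cInf_greatest) auto

lemma len_nonneg: "lifted \<Gamma> a b v \<Longrightarrow> 0 \<le> len \<Gamma> a b"
  by (rule len_ge) (auto intro: lifted_nonneg)

lemma len_approx:
  assumes "lifted \<Gamma> a b v" "0 < e"
  shows "\<exists>w. lifted \<Gamma> a b w \<and> w < len \<Gamma> a b + e"
  using cInf_lessD[of "{w. lifted \<Gamma> a b w}" "len \<Gamma> a b + e"] assms len_eq_Inf[OF assms(1)] by auto

lemma dist_le_len: "lifted \<Gamma> a b v \<Longrightarrow> D (\<Gamma> a) (\<Gamma> b) \<le> len \<Gamma> a b"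
  by (rule len_ge) (auto dest: lifted_dist)

lemma len_add:
  assumes "lifted \<Gamma> a b v" "a \<le> c" "c \<le> b"
  shows "len \<Gamma> a b = len \<Gamma> a c + len \<Gamma> c b"
proof (rule antisym)
  obtain u w where uw: "lifted \<Gamma> a c u" "lifted \<Gamma> c b w" using lifted_split[OF assms] by blast
  show "len \<Gamma> a b \<le> len \<Gamma> a c + len \<Gamma> c b"
  proof (rule field_le_epsilon)
    fix e :: real assume "0 < e"
    then obtain u' w' where "lifted \<Gamma> a c u'" "u' < len \<Gamma> a c + e / 2"
      "lifted \<Gamma> c b w'" "w' < len \<Gamma> c b + e / 2"
      using len_approx[OF uw(1), of "e / 2"] len_approx[OF uw(2), of "e / 2"] by auto
    then show "len \<Gamma> a b \<le> len \<Gamma> a c + len \<Gamma> c b + e"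
      using len_le[OF lifted_trans, of \<Gamma> c b w' a u'] by simp
  qed
  show "len \<Gamma> a c + len \<Gamma> c b \<le> len \<Gamma> a b"
  proof (rule len_ge[OF assms(1)])
    fix v' assume "lifted \<Gamma> a b v'"
    then obtain u' w' where "lifted \<Gamma> a c u'" "lifted \<Gamma> c b w'" "v' = u' + w'"
      using lifted_split assms(2,3) by blast
    then show "len \<Gamma> a c + len \<Gamma> c b \<le> v'" using len_le[of \<Gamma> a c u'] len_le[of \<Gamma> c b w'] by simp
  qed
qed

text \<open>The increment of \<open>t \<mapsto> len \<Gamma> a t\<close> over \<open>[s,t]\<close> is \<open>len \<Gamma> s t\<close>, which is at most the length
  of the part of any fixed lift over \<open>[s,t]\<close>.\<close>
lemma len_continuous:
  assumes "lifted \<Gamma> a b v"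
  shows "continuous_on {a..b} (\<lambda>t. len \<Gamma> a t)"
proof -
  obtain F where F: "continuous_on {a..b} F"
    and sub: "\<And>s t. a \<le> s \<Longrightarrow> s \<le> t \<Longrightarrow> t \<le> b \<Longrightarrow> lifted \<Gamma> s t (F t - F s)"
    using lifted_arclength[OF assms] by blast
  have mono: "0 \<le> len \<Gamma> a t - len \<Gamma> a s \<and> len \<Gamma> a t - len \<Gamma> a s \<le> F t - F s"
    if "a \<le> s" "s \<le> t" "t \<le> b" for s t
    using len_add[OF sub[of a t], of s] len_le[OF sub[of s t]] len_nonneg[OF sub[of s t]] that by simp
  have le: "dist (len \<Gamma> a s) (len \<Gamma> a t) \<le> dist (F s) (F t)" if "s \<in> {a..b}" "t \<in> {a..b}" for s t
    using mono[of s t] mono[of t s] that by (cases "s \<le> t") (auto simp: dist_real_def)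
  show ?thesis
    unfolding continuous_on_iff
  proof (intro ballI allI impI)
    fix x and e :: real assume x: "x \<in> {a..b}" and "0 < e"
    then obtain r where r: "0 < r" "\<And>y. y \<in> {a..b} \<Longrightarrow> dist y x < r \<Longrightarrow> dist (F y) (F x) < e"
      using F unfolding continuous_on_iff by blast
    have "dist (len \<Gamma> a y) (len \<Gamma> a x) < e" if "y \<in> {a..b}" "dist y x < r" for y
      using le[OF that(1) x] r(2)[OF that] by (rule order_le_less_trans)
    then show "\<exists>r>0. \<forall>y\<in>{a..b}. dist y x < r \<longrightarrow> dist (len \<Gamma> a y) (len \<Gamma> a x) < e"
      using r(1) by blast
  qed
qed

section \<open>Affine reparametrisation\<close>

lemma lift_piece_reparametrise:
  assumes "lift_piece \<Gamma> a b n p" "m \<noteq> 0" "(\<lambda>s. m * s + q) ` {c..e} = {a..b}"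
  shows "lift_piece (\<lambda>s. \<Gamma> (m * s + q)) c e n (\<lambda>j s. p j (m * s + q))"
    and "piece_length c e n (\<lambda>j s. p j (m * s + q)) = piece_length a b n p"
proof -
  have ab: "a < b" using assms(1) by (simp add: lift_piece_def)
  have "c < e"
  proof (rule ccontr)
    assume "\<not> c < e"
    then have "{c..e} \<subseteq> {c}" by auto
    then have "{a..b} \<subseteq> {m * c + q}" using assms(3) by blast
    with ab show False by (auto simp: subset_singleton_iff)
  qed
  then show "lift_piece (\<lambda>s. \<Gamma> (m * s + q)) c e n (\<lambda>j s. p j (m * s + q))"
    using assms(1) reparametrise(1)[OF _ assms(2,3)] equalityD1[OF assms(3)]
    by (simp add: lift_piece_def image_subset_iff)
  show "piece_length c e n (\<lambda>j s. p j (m * s + q)) = piece_length a b n p"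
    using assms(1) reparametrise(2)[OF _ assms(2,3)] by (simp add: piece_length_def lift_piece_def)
qed

lemma affine_image_pos: "0 < m \<Longrightarrow> a \<le> b \<Longrightarrow> (\<lambda>s. m * s + q) ` {(a - q) / m..(b - q) / m} = {a..b}"
  for m :: real
  by (subst image_affinity_atLeastAtMost) (auto simp: divide_right_mono)

lemma affine_image_neg: "m < 0 \<Longrightarrow> a \<le> b \<Longrightarrow> (\<lambda>s. m * s + q) ` {(b - q) / m..(a - q) / m} = {a..b}"
  for m :: real
  by (subst image_affinity_atLeastAtMost) (auto simp: divide_right_mono_neg)

lemma lifted_reparametrise_pos:
  "lifted \<Gamma> a b v \<Longrightarrow> 0 < m \<Longrightarrow> lifted (\<lambda>s. \<Gamma> (m * s + q)) ((a - q) / m) ((b - q) / m) v"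
proof (induction rule: lifted.induct)
  case (lifted_refl a)
  then show ?case by (auto intro: lifted.lifted_refl)
next
  case (lifted_snoc a c v b n p)
  have "c \<le> b" using lifted_snoc.hyps by (simp add: lift_piece_def)
  note piece = lift_piece_reparametrise[OF lifted_snoc.hyps(2) _ affine_image_pos[OF \<open>0 < m\<close> this, of q]]
  show ?case
    using lifted.lifted_snoc[OF lifted_snoc.IH[OF \<open>0 < m\<close>] piece(1)] piece(2) \<open>0 < m\<close> by simp
qed

text \<open>A decreasing map reverses the order of the pieces, so the last piece of \<open>\<Gamma>\<close> comes first
  and concatenation is needed where the increasing case only appends.\<close>
lemma lifted_reparametrise_neg:
  "lifted \<Gamma> a b v \<Longrightarrow> m < 0 \<Longrightarrow> lifted (\<lambda>s. \<Gamma> (m * s + q)) ((b - q) / m) ((a - q) / m) v"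
proof (induction rule: lifted.induct)
  case (lifted_refl a)
  then show ?case by (auto intro: lifted.lifted_refl)
next
  case (lifted_snoc a c v b n p)
  have "c \<le> b" using lifted_snoc.hyps by (simp add: lift_piece_def)
  note piece = lift_piece_reparametrise[OF lifted_snoc.hyps(2) _ affine_image_neg[OF \<open>m < 0\<close> this, of q]]
  show ?case
    using lifted_trans[OF lifted_snoc.IH[OF \<open>m < 0\<close>] lifted_single[OF piece(1)]] piece(2) \<open>m < 0\<close>
    by (simp add: add.commute)
qed

lemma lifted_reparametrise:
  assumes "lifted \<Gamma> a b v" "m \<noteq> 0" "(\<lambda>s. m * s + q) ` {c..e} = {a..b}"
  shows "lifted (\<lambda>s. \<Gamma> (m * s + q)) c e v"
proof -
  have "a \<le> b" by (rule lifted_le[OF assms(1)])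
  then have ce: "c \<le> e" using assms(3) by (metis atLeastatMost_empty_iff image_is_empty)
  show ?thesis
  proof (cases "0 < m")
    case True
    then have "a = m * c + q" "b = m * e + q"
      using assms(3) ce \<open>a \<le> b\<close> by (auto simp: image_affinity_atLeastAtMost Icc_eq_Icc)
    then show ?thesis using lifted_reparametrise_pos[OF assms(1) True, of q] True by simp
  next
    case False
    then have "m < 0" using assms(2) by simp
    then have "a = m * e + q" "b = m * c + q"
      using assms(3) ce \<open>a \<le> b\<close> by (auto simp: image_affinity_atLeastAtMost Icc_eq_Icc)
    then show ?thesis using lifted_reparametrise_neg[OF assms(1) \<open>m < 0\<close>, of q] \<open>m < 0\<close> by simp
  qed
qed

lemma lifted_reparametrise_iff:
  assumes "m \<noteq> 0" "(\<lambda>s. m * s + q) ` {c..e} = {a..b}"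
  shows "lifted (\<lambda>s. \<Gamma> (m * s + q)) c e v \<longleftrightarrow> lifted \<Gamma> a b v"
proof
  assume l: "lifted (\<lambda>s. \<Gamma> (m * s + q)) c e v"
  have inv: "m * (1 / m * s + - q / m) + q = s" "1 / m * (m * s + q) + - q / m = s" for s
    using assms(1) by (auto simp: field_simps)
  have "(\<lambda>s. 1 / m * s + - q / m) ` {a..b} = {c..e}"
    unfolding assms(2)[symmetric] image_image inv by simp
  from lifted_reparametrise[OF l _ this] show "lifted \<Gamma> a b v"
    using assms(1) unfolding inv by simp
qed (rule lifted_reparametrise[OF _ assms])

text \<open>For one-point intervals the given slope may be \<open>0\<close>; it can then be replaced by \<open>1\<close>.\<close>
lemma affine_homeo_coeffs:
  assumes "affine_homeo \<phi> c e a b" "a \<le> b"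
  obtains m q where "m \<noteq> 0" "(\<lambda>s. m * s + q) ` {c..e} = {a..b}" "\<And>s. s \<in> {c..e} \<Longrightarrow> \<phi> s = m * s + q"
proof -
  obtain m q where mq: "\<And>s. s \<in> {c..e} \<Longrightarrow> \<phi> s = m * s + q" and bij: "bij_betw \<phi> {c..e} {a..b}"
    using assms(1) unfolding affine_homeo_def by blast
  have im: "\<phi> ` {c..e} = {a..b}" using bij by (simp add: bij_betw_def)
  then have ce: "c \<le> e" using assms(2) by (metis atLeastatMost_empty_iff image_is_empty)
  show thesis
  proof (cases "c = e")
    case True
    show thesis
    proof (rule that[of 1 "\<phi> c - c"])
      show "(\<lambda>s. 1 * s + (\<phi> c - c)) ` {c..e} = {a..b}"
        unfolding im[symmetric] using True by simp
    qed (use True in auto)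
  next
    case False
    then have "\<phi> c \<noteq> \<phi> e" using bij ce by (auto simp: bij_betw_def inj_on_def)
    then have "m \<noteq> 0" using mq ce by auto
    moreover have "(\<lambda>s. m * s + q) ` {c..e} = {a..b}" using im mq by (metis (no_types, lifting) image_cong)
    ultimately show thesis using that mq by blast
  qed
qed

lemma lifted_affine_homeo:
  assumes "affine_homeo \<phi> c e a b" "a \<le> b"
  shows "lifted (compose {c..e} \<Gamma> \<phi>) c e v \<longleftrightarrow> lifted \<Gamma> a b v"
proof -
  obtain m q where mq: "m \<noteq> 0" "(\<lambda>s. m * s + q) ` {c..e} = {a..b}" "\<And>s. s \<in> {c..e} \<Longrightarrow> \<phi> s = m * s + q"
    using affine_homeo_coeffs[OF assms] by blast
  have "compose {c..e} \<Gamma> \<phi> = restrict (\<lambda>s. \<Gamma> (m * s + q)) {c..e}"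
    using mq(3) by (auto simp: compose_def fun_eq_iff)
  then show ?thesis by (simp add: lifted_path_on lifted_reparametrise_iff[OF mq(1,2)])
qed

section \<open>The length structure on the finite subsets\<close>

lemma length_structure_ran:
  "length_structure ran.mtopology (ran_paths \<omega> T P L) (ran_length \<omega> T P L)"
proof
  show "ran_paths \<omega> T P L \<subseteq> cpaths ran.mtopology"
    by (auto simp: ran_paths_def ran_topology_eq)
  show "0 \<le> ran_length \<omega> T P L p" if adm: "p \<in> ran_paths \<omega> T P L" for p
  proof -
    obtain a b \<Gamma> where p: "p = (a, b, \<Gamma>)" by (cases p)
    then obtain v where v: "lifted \<Gamma> a b v" using adm unfolding p ran_paths_iff by blast
    have "p = path_on \<Gamma> a b" using adm ran_paths_restrict unfolding p by blast
    then show ?thesis using len_nonneg[OF v] by simp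
  qed
  show "(a, b, \<Gamma>) \<in> ran_paths \<omega> T P L \<longleftrightarrow>
      path_on \<Gamma> a c \<in> ran_paths \<omega> T P L \<and> path_on \<Gamma> c b \<in> ran_paths \<omega> T P L"
    if "(a, b, \<Gamma>) \<in> cpaths ran.mtopology" "c \<in> {a..b}" for a b \<Gamma> c
  proof -
    have "\<Gamma> \<in> extensional {a..b}" using that by (simp add: cpaths_def)
    then have "(a, b, \<Gamma>) \<in> ran_paths \<omega> T P L \<longleftrightarrow> (\<exists>v. lifted \<Gamma> a b v)" by (simp add: ran_paths_iff)
    also have "\<dots> \<longleftrightarrow> (\<exists>u. lifted \<Gamma> a c u) \<and> (\<exists>w. lifted \<Gamma> c b w)"
      using that(2) lifted_split lifted_trans by (meson atLeastAtMost_iff)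
    finally show ?thesis by (simp only: ran_paths_path_on)
  qed
  show "ran_length \<omega> T P L (a, b, \<Gamma>) = len \<Gamma> a c + len \<Gamma> c b"
    if adm: "(a, b, \<Gamma>) \<in> ran_paths \<omega> T P L" and "c \<in> {a..b}" for a b \<Gamma> c
  proof -
    obtain v where v: "lifted \<Gamma> a b v" using adm by (auto simp: ran_paths_iff)
    show ?thesis using len_add[OF v, of c] that(2) by (subst ran_paths_restrict[OF that(1)]) simp
  qed
  show "(a, b, \<Gamma>) \<in> ran_paths \<omega> T P L \<longleftrightarrow> (c, e, compose {c..e} \<Gamma> \<phi>) \<in> ran_paths \<omega> T P L"
    if "(a, b, \<Gamma>) \<in> cpaths ran.mtopology" "affine_homeo \<phi> c e a b" for a b \<Gamma> c e \<phi>
    using that lifted_affine_homeo[OF that(2)] by (simp add: ran_paths_iff cpaths_def)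
  show "ran_length \<omega> T P L (a, b, \<Gamma>) = ran_length \<omega> T P L (c, e, compose {c..e} \<Gamma> \<phi>)"
    if adm: "(a, b, \<Gamma>) \<in> ran_paths \<omega> T P L" and "affine_homeo \<phi> c e a b" for a b \<Gamma> c e \<phi>
  proof -
    obtain v where v: "lifted \<Gamma> a b v" using adm by (auto simp: ran_paths_iff)
    note iff = lifted_affine_homeo[OF that(2) lifted_le[OF v], of \<Gamma>]
    have "(c, e, compose {c..e} \<Gamma> \<phi>) = path_on (compose {c..e} \<Gamma> \<phi>) c e"
      by (simp add: extensional_restrict)
    moreover have "lifted (compose {c..e} \<Gamma> \<phi>) c e v" using v by (simp add: iff)
    ultimately show ?thesis
      using len_eq_Inf[OF v] len_eq_Inf[of "compose {c..e} \<Gamma> \<phi>" c e v] 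
      by (simp add: ran_paths_restrict[OF that(1)] iff)
  qed
  show "continuous_on {a..b} (\<lambda>t. len \<Gamma> a t)" if "(a, b, \<Gamma>) \<in> ran_paths \<omega> T P L" for a b \<Gamma>
    using that len_continuous by (auto simp: ran_paths_iff)
  show "\<exists>\<epsilon>>0. \<forall>a b \<Gamma>. (a, b, \<Gamma>) \<in> ran_paths \<omega> T P L \<and> \<Gamma> a = X \<and> \<Gamma> b \<notin> U \<longrightarrow>
      ran_length \<omega> T P L (a, b, \<Gamma>) > \<epsilon>"
    if V: "openin ran.mtopology V" "X \<in> V" "V \<subseteq> U" for X U V
  proof -
    obtain r where r: "0 < r" "ran.mball X r \<subseteq> V"
      using V unfolding ran.openin_mtopology by blast
    have "r / 2 < ran_length \<omega> T P L (a, b, \<Gamma>)"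
      if \<Gamma>: "(a, b, \<Gamma>) \<in> ran_paths \<omega> T P L" "\<Gamma> a = X" "\<Gamma> b \<notin> U" for a b \<Gamma>
    proof -
      obtain v where v: "lifted \<Gamma> a b v" using \<Gamma> by (auto simp: ran_paths_iff)
      have "\<Gamma> b \<notin> ran.mball X r" using \<Gamma>(3) V(3) r(2) by blast
      then have "r \<le> D (\<Gamma> a) (\<Gamma> b)" using lifted_dist[OF v] \<Gamma>(2) by (simp add: ran.in_mball)
      also have "\<dots> \<le> ran_length \<omega> T P L (a, b, \<Gamma>)"
        using dist_le_len[OF v] by (simp only: ran_paths_restrict[OF \<Gamma>(1)])
      finally show ?thesis using r(1) by linarith
    qed
    then show ?thesis using r(1) by (intro exI[of _ "r / 2"]) auto
  qed
qed

section \<open>The weighted distance as a path distance\<close>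

text \<open>Passing through both points is enough: the part of the path between them has endpoints at
  these points, and the remaining parts only add length.\<close>
lemma dist_le_ran_length:
  assumes "(a, b, \<Gamma>) \<in> ran_paths \<omega> T P L" "s \<in> {a..b}" "t \<in> {a..b}"
  shows "D (\<Gamma> s) (\<Gamma> t) \<le> ran_length \<omega> T P L (a, b, \<Gamma>)"
proof -
  obtain v where v: "lifted \<Gamma> a b v" using assms by (auto simp: ran_paths_iff)
  have ordered: "D (\<Gamma> s) (\<Gamma> t) \<le> len \<Gamma> a b" if st: "a \<le> s" "s \<le> t" "t \<le> b" for s t
  proof -
    obtain u w x where l: "lifted \<Gamma> a s u" "lifted \<Gamma> s t w" "lifted \<Gamma> t b x" "lifted \<Gamma> s b (w + x)"
      using lifted_subinterval[OF v] lifted_trans st by (metis order_refl order_trans)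
    have "len \<Gamma> a b = len \<Gamma> a s + (len \<Gamma> s t + len \<Gamma> t b)"
      using len_add[OF v, of s] len_add[OF l(4), of t] st by simp
    then show ?thesis using dist_le_len[OF l(2)] len_nonneg[OF l(1)] len_nonneg[OF l(3)] by simp
  qed
  have "D (\<Gamma> s) (\<Gamma> t) \<le> len \<Gamma> a b"
    using ordered[of s t] ordered[of t s] assms(2,3) ran.commute[of "\<Gamma> s" "\<Gamma> t"] by (cases "s \<le> t") auto
  then show ?thesis by (simp only: ran_paths_restrict[OF assms(1)])
qed

text \<open>All coordinates run over the same interval \<open>[c,c']\<close>, and each pair of \<open>R\<close> needs its own
  coordinate, even \<open>(x, x)\<close>; hence the assumption that there are at least two points.\<close>
lemma surj_rel_path:
  assumes R: "surj_rel R X Y" and XY: "X \<in> Fin" "Y \<in> Fin"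
    and two: "\<And>x. \<not> topspace T \<subseteq> {x}" and "c < c'" "0 < e"
  shows "\<exists>\<Gamma> w. lifted \<Gamma> c c' w \<and> \<Gamma> c = X \<and> \<Gamma> c' = Y \<and> w \<le> rel_length \<omega> d R + e"
proof -
  define n where "n = card R"
  have "finite R" "R \<noteq> {}" using surj_rel_finite[OF R XY] surj_rel_nonempty[OF R XY(1)] by auto
  then have n: "1 \<le> n" by (simp add: n_def Suc_leI card_gt_0_iff)
  then have w: "1 \<le> \<omega> n" by (rule weight_ge_1[OF weight])
  obtain f where f: "bij_betw f {..<n} R"
    using ex_bij_betw_nat_finite[OF \<open>finite R\<close>] by (auto simp: n_def atLeast0LessThan)
  \<comment> \<open>The total error is \<open>\<omega> n\<close> times \<open>n\<close> times the error of one coordinate.\<close>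
  define \<delta> where "\<delta> = e / (\<omega> n * n)"
  have "0 < \<delta>" using \<open>0 < e\<close> n w by (simp add: \<delta>_def)
  have "\<exists>\<eta>. path_on \<eta> c c' \<in> P \<and> \<eta> c = fst (f j) \<and> \<eta> c' = snd (f j) \<and>
      L (path_on \<eta> c c') \<le> d (fst (f j)) (snd (f j)) + \<delta>" if "j < n" for j
  proof (rule short_path)
    have "f j \<in> R" using f that by (auto simp: bij_betw_def)
    then show "fst (f j) \<in> topspace T" "snd (f j) \<in> topspace T"
      using R XY by (auto simp: surj_rel_def Ran_def)
  qed (use assms two \<open>0 < \<delta>\<close> in auto)
  then obtain p where p: "\<And>j. j < n \<Longrightarrow> path_on (p j) c c' \<in> P \<and> p j c = fst (f j) \<and> p j c' = snd (f j) \<and>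
      L (path_on (p j) c c') \<le> d (fst (f j)) (snd (f j)) + \<delta>"
    by metis
  define \<Gamma> where "\<Gamma> s = (\<lambda>j. p j s) ` {..<n}" for s
  have "lift_piece \<Gamma> c c' n p"
    using n p \<open>c < c'\<close> by (auto simp: lift_piece_def \<Gamma>_def)
  then have "lifted \<Gamma> c c' (piece_length c c' n p)" by (rule lifted_single)
  moreover have "\<Gamma> c = X" "\<Gamma> c' = Y"
  proof -
    have fR: "f ` {..<n} = R" using f by (simp add: bij_betw_def)
    have "\<Gamma> c = fst ` f ` {..<n}" "\<Gamma> c' = snd ` f ` {..<n}"
      using p by (auto simp: \<Gamma>_def image_image)
    then show "\<Gamma> c = X" "\<Gamma> c' = Y" using R unfolding fR surj_rel_def by auto
  qed
  moreover have "piece_length c c' n p \<le> rel_length \<omega> d R + e"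
  proof -
    have "(\<Sum>j<n. L (path_on (p j) c c')) \<le> (\<Sum>j<n. d (fst (f j)) (snd (f j)) + \<delta>)"
      using p by (intro sum_mono) auto
    also have "\<dots> = (\<Sum>j<n. d (fst (f j)) (snd (f j))) + n * \<delta>" by (simp add: sum.distrib)
    also have "(\<Sum>j<n. d (fst (f j)) (snd (f j))) = (\<Sum>(x, y)\<in>R. d x y)"
      using sum.reindex_bij_betw[OF f, of "\<lambda>(x, y). d x y"] by (simp add: case_prod_unfold)
    finally have "piece_length c c' n p \<le> \<omega> n * ((\<Sum>(x, y)\<in>R. d x y) + n * \<delta>)"
      unfolding piece_length_def using w by (intro mult_left_mono) linarith+
    also have "\<dots> = rel_length \<omega> d R + e"
      using n w by (simp add: rel_length_def n_def[symmetric] distrib_left \<delta>_def)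
    finally show ?thesis .
  qed
  ultimately show ?thesis by blast
qed

lemma lifted_concat:
  assumes "lifted \<Gamma>\<^sub>1 a c v" "lifted \<Gamma>\<^sub>2 c b w" "\<Gamma>\<^sub>1 c = \<Gamma>\<^sub>2 c"
  shows "lifted (\<lambda>s. if s \<le> c then \<Gamma>\<^sub>1 s else \<Gamma>\<^sub>2 s) a b (v + w)"
proof (rule lifted_trans)
  show "lifted (\<lambda>s. if s \<le> c then \<Gamma>\<^sub>1 s else \<Gamma>\<^sub>2 s) c b w"
    by (rule lifted_cong[OF assms(2)]) (use assms(3) in auto)
  show "lifted (\<lambda>s. if s \<le> c then \<Gamma>\<^sub>1 s else \<Gamma>\<^sub>2 s) a c v"
    by (rule lifted_cong[OF assms(1)]) auto
qed

text \<open>The \<open>j\<close>-th relation of the chain is followed on \<open>[j, j+1]\<close>, with half of the remaining error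
  allowance.\<close>
lemma chain_path:
  assumes "chain X Y v" and two: "\<And>x. \<not> topspace T \<subseteq> {x}" and "0 < e"
  shows "\<exists>\<Gamma> b w. lifted \<Gamma> 0 b w \<and> \<Gamma> 0 = X \<and> \<Gamma> b = Y \<and> w \<le> v + e"
  using assms(1,3)
proof (induction arbitrary: e rule: chain.induct)
  case (chain_refl X)
  then have "lifted (\<lambda>_. X) 0 0 0" by (intro lifted_refl)
  then show ?case using \<open>0 < e\<close> by force
next
  case (chain_step X Y v R Z)
  obtain \<Gamma>\<^sub>1 b w\<^sub>1 where 1: "lifted \<Gamma>\<^sub>1 0 b w\<^sub>1" "\<Gamma>\<^sub>1 0 = X" "\<Gamma>\<^sub>1 b = Y" "w\<^sub>1 \<le> v + e / 2"
    using chain_step.IH[of "e / 2"] \<open>0 < e\<close> by auto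
  have "Y \<in> Fin" using chain_Ran chain_step.hyps by blast
  then obtain \<Gamma>\<^sub>2 w\<^sub>2 where 2: "lifted \<Gamma>\<^sub>2 b (b + 1) w\<^sub>2" "\<Gamma>\<^sub>2 b = Y" "\<Gamma>\<^sub>2 (b + 1) = Z"
    "w\<^sub>2 \<le> rel_length \<omega> d R + e / 2"
    using surj_rel_path[OF chain_step.hyps(2) _ chain_step.hyps(3) two, of b "b + 1" "e / 2"] \<open>0 < e\<close> by auto
  have "0 \<le> b" by (rule lifted_le[OF 1(1)])
  with lifted_concat[OF 1(1) 2(1)] 1 2 show ?case
    by (intro exI[of _ "\<lambda>s. if s \<le> b then \<Gamma>\<^sub>1 s else \<Gamma>\<^sub>2 s"] exI[of _ "b + 1"] exI[of _ "w\<^sub>1 + w\<^sub>2"]) auto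
qed

lemma almost_shortest_ran_path:
  assumes "X \<in> Fin" "Y \<in> Fin" "0 < e"
  shows "\<exists>a b \<Gamma>. (a, b, \<Gamma>) \<in> ran_paths \<omega> T P L \<and> a \<le> b \<and> \<Gamma> a = X \<and> \<Gamma> b = Y \<and>
    ran_length \<omega> T P L (a, b, \<Gamma>) \<le> D X Y + e"
proof -
  have "\<exists>\<Gamma> b w. lifted \<Gamma> 0 b w \<and> \<Gamma> 0 = X \<and> \<Gamma> b = Y \<and> w \<le> D X Y + e"
  proof (cases "X = Y")
    case True
    then have "lifted (\<lambda>_. X) 0 0 0" using assms(1) by (intro lifted_refl)
    moreover have "0 \<le> D X Y + e" using ran.nonneg[of X Y] assms(3) by simp
    ultimately show ?thesis using True by blast
  next
    case False
    have two: "\<not> topspace T \<subseteq> {x}" for x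
    proof
      assume "topspace T \<subseteq> {x}"
      then have "X = {x}" "Y = {x}" using assms(1,2) unfolding Ran_def by blast+
      with False show False by simp
    qed
    obtain v where "chain X Y v" "v < D X Y + e / 2"
      using ran_dist_approx[OF assms(1,2), of "e / 2"] assms(3) by auto
    with chain_path[OF this(1) two, of "e / 2"] assms(3) show ?thesis by force
  qed
  then obtain \<Gamma> b w where l: "lifted \<Gamma> 0 b w" "\<Gamma> 0 = X" "\<Gamma> b = Y" "w \<le> D X Y + e" by blast
  have "path_on \<Gamma> 0 b \<in> ran_paths \<omega> T P L" using l(1) ran_paths_path_on by blast
  moreover have "len \<Gamma> 0 b \<le> D X Y + e" using len_le[OF l(1)] l(4) by simp
  ultimately show ?thesis using l lifted_le[OF l(1)] by (intro exI[of _ 0] exI[of _ b] exI[of _ "restrict \<Gamma> {0..b}"]) auto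
qed

text \<open>Both infima are squeezed: paths between the two sets are among those that pass through
  them, which are no shorter than the distance, and the almost shortest paths attain it up to \<open>e\<close>.\<close>
lemma length_edist_ran:
  assumes "X \<in> Fin" "Y \<in> Fin"
  shows "length_edist (ran_paths \<omega> T P L) (ran_length \<omega> T P L) X Y = ereal (D X Y)"
    and "ereal (D X Y) = Inf {ereal (ran_length \<omega> T P L (a, b, \<Gamma>)) |a b \<Gamma>.
                    (a, b, \<Gamma>) \<in> ran_paths \<omega> T P L \<and> \<Gamma> a = X \<and> \<Gamma> b = Y}" (is "_ = Inf ?E")
proof -
  let ?I = "{ereal (ran_length \<omega> T P L (a, b, \<Gamma>)) |a b \<Gamma>.
    (a, b, \<Gamma>) \<in> ran_paths \<omega> T P L \<and> X \<in> \<Gamma> ` {a..b} \<and> Y \<in> \<Gamma> ` {a..b}}"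
  have "ereal (D X Y) \<le> Inf ?I"
    using dist_le_ran_length by (intro Inf_greatest) fastforce
  moreover have "Inf ?I \<le> Inf ?E"
  proof (rule Inf_superset_mono, rule subsetI)
    fix l assume "l \<in> ?E"
    then obtain a b \<Gamma> where \<Gamma>: "l = ereal (ran_length \<omega> T P L (a, b, \<Gamma>))"
      "(a, b, \<Gamma>) \<in> ran_paths \<omega> T P L" "\<Gamma> a = X" "\<Gamma> b = Y" by blast
    then have "a \<le> b" using lifted_le by (auto simp: ran_paths_iff)
    then have "X \<in> \<Gamma> ` {a..b}" "Y \<in> \<Gamma> ` {a..b}" using \<Gamma>(3,4) by auto
    with \<Gamma>(1,2) show "l \<in> ?I" by blast
  qed
  moreover have "Inf ?E \<le> ereal (D X Y)"
  proof (rule ereal_le_epsilon2)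
    fix e :: real assume "0 < e"
    then obtain a b \<Gamma> where \<Gamma>: "(a, b, \<Gamma>) \<in> ran_paths \<omega> T P L" "\<Gamma> a = X" "\<Gamma> b = Y"
      "ran_length \<omega> T P L (a, b, \<Gamma>) \<le> D X Y + e"
      using almost_shortest_ran_path[OF assms] by blast
    have "Inf ?E \<le> ereal (ran_length \<omega> T P L (a, b, \<Gamma>))"
      by (rule Inf_lower) (use \<Gamma> in blast)
    also have "\<dots> \<le> ereal (D X Y) + ereal e" using \<Gamma>(4) by simp
    finally show "Inf ?E \<le> ereal (D X Y) + ereal e" .
  qed
  ultimately have "Inf ?I = ereal (D X Y)" "Inf ?E = ereal (D X Y)" by order+
  then show "length_edist (ran_paths \<omega> T P L) (ran_length \<omega> T P L) X Y = ereal (D X Y)"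
    "ereal (D X Y) = Inf ?E" by (simp_all add: length_edist_def)
qed

end

section \<open>The weighted distance comes from a length structure\<close>

theorem theorem4:
  fixes T :: "'a topology" and P :: "'a ipath set" and L :: "'a ipath \<Rightarrow> real"
    and \<omega> :: "nat \<Rightarrow> real"
  assumes "length_space T P L" and "weight \<omega>"
  shows "Metric_space (Ran (topspace T)) (ran_dist \<omega> (topspace T) (length_dist P L)) \<and>
    length_structure (ran_topology \<omega> (topspace T) (length_dist P L))
           (ran_paths \<omega> T P L) (ran_length \<omega> T P L) \<and>
    (\<forall>X\<in>Ran (topspace T). \<forall>Y\<in>Ran (topspace T).
           length_edist (ran_paths \<omega> T P L) (ran_length \<omega> T P L) X Y =
             ereal (ran_dist \<omega> (topspace T) (length_dist P L) X Y)) \<and>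
    (\<forall>X\<in>Ran (topspace T). \<forall>Y\<in>Ran (topspace T).
           ereal (ran_dist \<omega> (topspace T) (length_dist P L) X Y) =
             Inf {ereal (ran_length \<omega> T P L (a, b, \<Gamma>)) |a b \<Gamma>.
                    (a, b, \<Gamma>) \<in> ran_paths \<omega> T P L \<and> \<Gamma> a = X \<and> \<Gamma> b = Y})"
proof -
  interpret weighted_length_space T P L \<omega>
    using assms by (simp add: weighted_length_space_def weighted_length_space_axioms_def)
  show ?thesis
    unfolding ran_topology_eq
    by (intro conjI ballI Metric_space_ran_dist length_structure_ran length_edist_ran)
qed

end
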